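(* Consider the freight marketplace, its $\theta$-scaled instances, the static posted price mechanism $\mathsf{SP}$ and the hybrid mechanism $\mathsf{HYB}$ described in the context. There exists a problem instance such that $$\gamma^{\mathsf{HYB}}(\theta)-\gamma^{\mathsf{SP}}(\theta)\ge\Omega(\sqrt\theta),$$ and therefore $\gamma^{\mathsf{SP}}(\theta)/\gamma^{\mathsf{HYB}}(\theta)=1-\Omega(1/\sqrt\theta)$, as $\theta\to\infty$.
   Context: Network and dynamics. $\mathcal N=\{1,\dots,n\}$ is a set of nodes and $\mathcal E\subseteq\mathcal N\times\mathcal N$ a set of lanes, containing all self-loops; $\delta^+(j)=\{k:(j,k)\in\mathcal E\}$, $\delta^-(j)=\{i:(i,j)\in\mathcal E\}$. Time is discrete. At the beginning of period $t$ there are $S_{it}$ carriers available at node $i$ and $D_{ijt}$ loads on lane $(i,j)$. Under shipper prices $r_{ijt}$ in period $t$, $D_{ij,t+1}$ is Poisson with mean $d_{ij}(r_{ijt})$, where $d_{ij}(\cdot)$ is strictly decreasing with inverse $r_{ij}(\cdot)$ and $d\mapsto r_{ij}(d)d$ is concave. Each carrier transports at most one load per period and each trip takes one period. $Y_{ijt}\le D_{ijt}$ is the number of carriers transporting a load on $(i,j)$; the other carriers at node $i$ leave the marketplace. Given $Y_{ijt}$, the number $Z_{ijt}$ of carriers who stay (at node $j$) is Binomial$(Y_{ijt},q_{ij})$ with $q_{ij}\in[0,1)$, and $S_{j,t+1}=\sum_{i\in\delta^-(j)}Z_{ijt}+\Lambda_{j,t+1}$ with $\Lambda_{j,t+1}$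 Poisson of rate $\lambda_j>0$. Unmatched loads expire at unit penalty cost $b_{ij}$. With $P_{ijt}$ the total payment to carriers on lane $(i,j)$, the expected period profit is $\mathrm E[\sum_{(i,j)\in\mathcal E}r_{ijt}d_{ij}(r_{ijt})-b_{ij}(D_{ijt}-Y_{ijt})-P_{ijt}]$, and the long-run average profit of a mechanism is the limit of its time averages. Carrier costs. A carrier $s$ at node $i$ paid $p$ for a load on $(i,j)$ has utility $U^s_{ijt}=\beta p-\alpha_{ij}+\epsilon^s_{ijt}$, and $\epsilon^s_{i0t}$ for the outside option (leaving), with $\beta>0$, $\alpha_{ij}>0$ and all $\epsilon$'s i.i.d. Gumbel (location 0, scale 1). His true opportunity cost is $C^s_{ijt}=(\alpha_{ij}-\epsilon^s_{ijt}+\epsilon^s_{i0t})/\beta$. Problem instance: a choice of a node set $\mathcal N=\{1,\dots,n\}$, a lane set $\mathcal E\subseteq\mathcal N\times\mathcal N$ containing all self-loops, strictly decreasing demand functions $d_{ij}(\cdot)$ with inverses $r_{ij}(\cdot)$ such that $d\mapsto r_{ij}(d)d$ is concave, and parameters $b_{ij}$ (unit penalty costs), $q_{ij}\in[0,1)$ (staying probabilities), $\lambda_i>0$ (carrier arrival rates), $\alpha_{ij}>0$ (average carrier costs) and $\beta>0$ (price sensitivity). Fluid prices. Let $(\mathbf d^*,\bar{\mathbf y}^*,\bar{\mathbf v}^* )$ be an optimal solution of the fluid problem $(\mathsf{FA})$: maximize $\sum_{(i,j)\in\mathcal E}r_{ij}(d_{ij})d_{ij}-\frac1\beta[\ln(\bar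 y_{ij}/\bar v_i)+\alpha_{ij}]\bar y_{ij}-b_{ij}(d_{ij}-\bar y_{ij})$ subject to $\sum_{i\in\delta^-(j)}q_{ij}\bar y_{ij}+\lambda_j=\sum_{k\in\delta^+(j)}\bar y_{jk}+\bar v_j$ for all $j$, $0\le\bar y_{ij}\le d_{ij}$ for all $(i,j)$, $\bar v_i\ge0$ for all $i$. Put $r^*_{ij}=r_{ij}(d^*_{ij})$ and $p^*_{ij}=\frac1\beta[\ln(\bar y^*_{ij}/\bar v^*_i)+\alpha_{ij}]$. The optimal value of $(\mathsf{FA})$ is assumed strictly positive. Scaling. For $\theta\in\{1,2,\dots\}$ the $\theta$-scaled instance has demand functions $\theta d_{ij}(\cdot)$ and carrier arrival rates $\theta\lambda_i$, all other parameters unchanged; the prices $(\mathbf r^*,\mathbf p^* )$ are the same for all $\theta$. $\gamma^{\mathsf{SP}}(\theta)$ and $\gamma^{\mathsf{HYB}}(\theta)$ are the long-run average profits of the two mechanisms $\mathsf{SP}$ and $\mathsf{HYB}$ in the $\theta$-scaled instance. Mechanism $\mathsf{SP}$. In all states and periods shippers are charged $\mathbf r^*$ and carriers are offered $\mathbf p^*$. In each period carriers at node $i$ arrive sequentially; each chooses the utility-maximizing option among the lanes $(i,j)$ with unbooked loads remaining and the outside option. Each carrier who books on $(i,j)$ is paid $p^*_{ij}$. Virtual cost and reserve price. $F_{ij}(c)=\Pr\{C^s_{ijt}\le c\mid C^s_{ijt}<(p^*_{ij}-p^*_{ik})+C^s_{ikt}\ \forall k\in\delta^+(i),k\ne j\}$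 with density $f_{ij}$; $\psi_{ij}(c)=c+F_{ij}(c)/f_{ij}(c)$ (strictly increasing, with inverse $\psi_{ij}^{-1}$); $\xi^*_{ij}=\max\{\psi_{ij}^{-1}(b_{ij}),p^*_{ij}\}$. Auction $\mathsf{AUC}$ on lane $(i,j)$ in period $t$. Let $\tilde{\mathcal S}_{ijt}$ be the set of carriers who chose lane $(i,j)$, with bid vector $\mathbf C_{ijt}$. The allocation $A^{s,\mathsf{AUC}}_{ijt}$ is an (integral) optimal solution of $$\mathcal J_{ij}(\mathbf C_{ijt})=\min\Big\{\sum_{s\in\tilde{\mathcal S}_{ijt}}C^s_{ijt}A^s+\xi^*_{ij}Y^0:\ 0\le A^s\le1,\ \sum_sA^s+Y^0=D_{ijt},\ Y^0\ge0\Big\},$$ and $P^{s,\mathsf{AUC}}_{ijt}(\mathbf C_{ijt})=C^s_{ijt}A^{s,\mathsf{AUC}}_{ijt}(\mathbf C_{ijt})+\mathcal J_{ij}(\mathbf C^{-s}_{ijt})-\mathcal J_{ij}(\mathbf C_{ijt})$, where $\mathbf C^{-s}_{ijt}$ omits carrier $s$. (Equivalently: a uniform price auction with reserve price; the lowest $D_{ijt}$ bids below $\xi^*_{ij}$ win, and each winner is paid the smaller of $\xi^*_{ij}$ and the $(D_{ijt}+1)$-th lowest bid.) Mechanism $\mathsf{HYB}$. Shippers are charged $\mathbf r^*$. In a first stage each carrier at node $i$ chooses the lane $(i,j)$ maximizing his utility at the posted prices $\mathbf p^*$ among the available lanes (multinomial logit; the outside option is considered only in the second stage), then submits a bid. A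 carrier bidding at most $p^*_{ij}$ is assigned a load immediately and guaranteed at least $p^*_{ij}$; a carrier bidding more waits for the auction. If all loads on $(i,j)$ have been booked and another carrier with bid at most $p^*_{ij}$ arrives, the booked carriers are paid $p^*_{ij}$ and all future carriers at node $i$ in the period can no longer choose $(i,j)$, choosing another available lane by the multinomial logit model; otherwise $\mathsf{AUC}$ is conducted at the end of the period. Formally, with $X^{\mathsf{SP}}_{ijt}(\mathbf C_{ijt})$ the number of carriers who would choose to deliver a load on $(i,j)$ under $\mathsf{SP}$ with posted price $p^*_{ij}$ when bids are $\mathbf C_{ijt}$ (those bidding at most $p^*_{ij}$), and $A^{s,\mathsf{SP}}_{ijt}$ the allocation under $\mathsf{SP}$: if $X^{\mathsf{SP}}_{ijt}(\mathbf C_{ijt})>D_{ijt}$, then $A^{s,\mathsf{HYB}}_{ijt}=A^{s,\mathsf{SP}}_{ijt}$ and $P^{s,\mathsf{HYB}}_{ijt}=p^*_{ij}A^{s,\mathsf{HYB}}_{ijt}$; otherwise $A^{s,\mathsf{HYB}}_{ijt}=A^{s,\mathsf{AUC}}_{ijt}$ and $P^{s,\mathsf{HYB}}_{ijt}=P^{s,\mathsf{AUC}}_{ijt}$. Carriers bid their true opportunity costs. Notation: $f(\theta)\ge\Omega(\sqrt\theta)$ means that there is a constant $c>0$ with $f(\theta)\ge c\sqrt\theta$ for all sufficiently large $\theta$; similarly for $\Omega(1/\sqrt\theta)$. *)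

theory Defs
  imports "HOL-Probability.Probability"
begin

type_synonym lane = "nat \<times> nat"

(* Nodes are 1, ..., num_nodes.  A shock e (i, s, k) is the utility shock of the s-th carrier to
   arrive at node i (s = 0, 1, ...) for the lane (i, k); the index k = 0 is the outside option. *)

type_synonym shocks = "nat \<times> nat \<times> nat \<Rightarrow> real"

record market =
  num_nodes :: nat
  lanes :: "lane set"
  prices :: "lane \<Rightarrow> real set"       (* domain of the demand function *)
  demand :: "lane \<Rightarrow> real \<Rightarrow> real"
  penalty :: "lane \<Rightarrow> real"
  stay :: "lane \<Rightarrow> real"
  arrival :: "nat \<Rightarrow> real"
  avg_cost :: "lane \<Rightarrow> real"
  sensitivity :: real

definition nodes :: "market \<Rightarrow> nat set" where
  "nodes m = {1..num_nodes m}"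

definition succs :: "market \<Rightarrow> nat \<Rightarrow> nat set" where
  "succs m j = {k. (j, k) \<in> lanes m}"

definition preds :: "market \<Rightarrow> nat \<Rightarrow> nat set" where
  "preds m j = {i. (i, j) \<in> lanes m}"

definition inv_demand :: "market \<Rightarrow> lane \<Rightarrow> real \<Rightarrow> real" where
  "inv_demand m l = the_inv_into (prices m l) (demand m l)"

definition valid_market :: "market \<Rightarrow> bool" where
  "valid_market m \<longleftrightarrow>
     1 \<le> num_nodes m \<and>
     lanes m \<subseteq> nodes m \<times> nodes m \<and>
     (\<forall>i\<in>nodes m. (i, i) \<in> lanes m) \<and>
     (\<forall>l\<in>lanes m.
        is_interval (prices m l) \<and> interior (prices m l) \<noteq> {} \<and>
        (\<forall>x\<in>prices m l. 0 \<le> demand m l x) \<and>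
        strict_antimono_on (prices m l) (demand m l) \<and>
        concave_on (demand m l ` prices m l) (\<lambda>d. inv_demand m l d * d)) \<and>
     (\<forall>l\<in>lanes m. 0 \<le> penalty m l \<and> 0 \<le> stay m l \<and> stay m l < 1 \<and> 0 < avg_cost m l) \<and>
     (\<forall>i\<in>nodes m. 0 < arrival m i) \<and>
     0 < sensitivity m"

definition scaled :: "nat \<Rightarrow> market \<Rightarrow> market" where
  "scaled \<theta> m = m\<lparr>demand := \<lambda>l x. real \<theta> * demand m l x, arrival := \<lambda>i. real \<theta> * arrival m i\<rparr>"

(* The conjunct "v i = 0 --> y (i, j) = 0" restricts to the effective domain of the objective:
   y * ln (y / v) is +infinity for y > 0 = v, whereas the library's total functions would
   return 0.  For y = 0 both readings give 0. *)

definition fluid_feasible ::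
    "market \<Rightarrow> (lane \<Rightarrow> real) \<Rightarrow> (lane \<Rightarrow> real) \<Rightarrow> (nat \<Rightarrow> real) \<Rightarrow> bool" where
  "fluid_feasible m d y v \<longleftrightarrow>
     (\<forall>j\<in>nodes m. (\<Sum>i\<in>preds m j. stay m (i, j) * y (i, j)) + arrival m j =
                   (\<Sum>k\<in>succs m j. y (j, k)) + v j) \<and>
     (\<forall>l\<in>lanes m. d l \<in> demand m l ` prices m l \<and> 0 \<le> y l \<and> y l \<le> d l) \<and>
     (\<forall>i\<in>nodes m. 0 \<le> v i) \<and>
     (\<forall>(i, j)\<in>lanes m. v i = 0 \<longrightarrow> y (i, j) = 0)"

definition fluid_objective ::
    "market \<Rightarrow> (lane \<Rightarrow> real) \<Rightarrow> (lane \<Rightarrow> real) \<Rightarrow> (nat \<Rightarrow> real) \<Rightarrow> real" where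
  "fluid_objective m d y v =
     (\<Sum>(i, j)\<in>lanes m.
        inv_demand m (i, j) (d (i, j)) * d (i, j)
        - 1 / sensitivity m * (ln (y (i, j) / v i) + avg_cost m (i, j)) * y (i, j)
        - penalty m (i, j) * (d (i, j) - y (i, j)))"

definition fluid_optimal ::
    "market \<Rightarrow> (lane \<Rightarrow> real) \<Rightarrow> (lane \<Rightarrow> real) \<Rightarrow> (nat \<Rightarrow> real) \<Rightarrow> bool" where
  "fluid_optimal m d y v \<longleftrightarrow>
     fluid_feasible m d y v \<and>
     (\<forall>d' y' v'. fluid_feasible m d' y' v' \<longrightarrow> fluid_objective m d' y' v' \<le> fluid_objective m d y v)"

definition shipper_price :: "market \<Rightarrow> (lane \<Rightarrow> real) \<Rightarrow> lane \<Rightarrow> real" where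
  "shipper_price m d l = inv_demand m l (d l)"

(* The marginal value of y * ln (y / v) at y = 0 is -infinity, so an optimal solution has y > 0
   and v > 0 and the logarithm is never evaluated at its junk value. *)

definition carrier_price ::
    "market \<Rightarrow> (lane \<Rightarrow> real) \<Rightarrow> (nat \<Rightarrow> real) \<Rightarrow> lane \<Rightarrow> real" where
  "carrier_price m y v l = 1 / sensitivity m * (ln (y l / v (fst l)) + avg_cost m l)"

definition gumbel :: "real measure" where
  "gumbel = density lborel (\<lambda>x. ennreal (exp (- (x + exp (- x)))))"

definition shock_space :: "shocks measure" where
  "shock_space = Pi\<^sub>M UNIV (\<lambda>_. gumbel)"

definition utility ::
    "market \<Rightarrow> (lane \<Rightarrow> real) \<Rightarrow> shocks \<Rightarrow> nat \<Rightarrow> nat \<Rightarrow> nat \<Rightarrow> real" where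
  "utility m p e i s k =
     (if k = 0 then e (i, s, 0)
      else sensitivity m * p (i, k) - avg_cost m (i, k) + e (i, s, k))"

definition cost :: "market \<Rightarrow> shocks \<Rightarrow> nat \<Rightarrow> nat \<Rightarrow> nat \<Rightarrow> real" where
  "cost m e i s j = (avg_cost m (i, j) - e (i, s, j) + e (i, s, 0)) / sensitivity m"

(* Ties have probability zero; a deterministic rule keeps the choice measurable. *)

definition best :: "(nat \<Rightarrow> real) \<Rightarrow> nat set \<Rightarrow> nat" where
  "best u A = (LEAST k. k \<in> A \<and> (\<forall>l\<in>A. u l \<le> u k))"

(* The law does not depend on the carrier; carrier 0 is used as a representative. *)

definition cost_cdf :: "market \<Rightarrow> (lane \<Rightarrow> real) \<Rightarrow> lane \<Rightarrow> real \<Rightarrow> real" where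
  "cost_cdf m p = (\<lambda>(i, j) c.
     \<P>(e in shock_space. cost m e i 0 j \<le> c \<bar>
        (\<forall>k\<in>succs m i - {j}. cost m e i 0 j < (p (i, j) - p (i, k)) + cost m e i 0 k)))"

definition virtual_cost :: "market \<Rightarrow> (lane \<Rightarrow> real) \<Rightarrow> lane \<Rightarrow> real \<Rightarrow> real" where
  "virtual_cost m p l c = c + cost_cdf m p l c / deriv (cost_cdf m p l) c"

definition reserve_price :: "market \<Rightarrow> (lane \<Rightarrow> real) \<Rightarrow> lane \<Rightarrow> real" where
  "reserve_price m p l = max (inv (virtual_cost m p l) (penalty m l)) (p l)"

(* A mechanism maps the carriers S and loads D present in a period and the carriers' shocks to
   the number of loads transported on each lane and the total payment on each lane. *)

type_synonym mechanism =
  "(nat \<Rightarrow> nat) \<Rightarrow> (lane \<Rightarrow> nat) \<Rightarrow> shocks \<Rightarrow> lane \<Rightarrow> nat \<times> real"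

(* sp_booked m p D e i s j is the number of loads on (i, j) booked by the first s carriers. *)

primrec sp_booked ::
    "market \<Rightarrow> (lane \<Rightarrow> real) \<Rightarrow> (lane \<Rightarrow> nat) \<Rightarrow> shocks \<Rightarrow> nat \<Rightarrow> nat \<Rightarrow> nat \<Rightarrow> nat" where
  "sp_booked m p D e i 0 = (\<lambda>_. 0)"
| "sp_booked m p D e i (Suc s) =
     (let x = sp_booked m p D e i s;
          k = best (utility m p e i s) (insert 0 {j \<in> succs m i. x j < D (i, j)})
      in if k = 0 then x else x(k := x k + 1))"

definition SP :: "market \<Rightarrow> (lane \<Rightarrow> real) \<Rightarrow> mechanism" where
  "SP m p S D e = (\<lambda>(i, j).
     let x = sp_booked m p D e i (S i) j in (x, p (i, j) * real x))"

(* The auction on one lane: B is the set of bidders, N the number of loads, x the reserve price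
   and c the bids. *)

definition auction_feasible :: "nat set \<Rightarrow> nat \<Rightarrow> (nat \<Rightarrow> real) \<Rightarrow> real \<Rightarrow> bool" where
  "auction_feasible B N A y \<longleftrightarrow> (\<forall>s\<in>B. 0 \<le> A s \<and> A s \<le> 1) \<and> sum A B + y = real N \<and> 0 \<le> y"

definition auction_cost ::
    "nat set \<Rightarrow> real \<Rightarrow> (nat \<Rightarrow> real) \<Rightarrow> (nat \<Rightarrow> real) \<Rightarrow> real \<Rightarrow> real" where
  "auction_cost B x c A y = (\<Sum>s\<in>B. c s * A s) + x * y"

definition auction_value :: "nat set \<Rightarrow> nat \<Rightarrow> real \<Rightarrow> (nat \<Rightarrow> real) \<Rightarrow> real" where
  "auction_value B N x c = Inf {auction_cost B x c A y |A y. auction_feasible B N A y}"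

(* The winners form an integral optimal solution.  It is unique unless there are ties, which have
   probability zero; these are broken by the least code in the enumeration of the finite sets of
   naturals, which keeps the allocation measurable. *)

definition auction_winners :: "nat set \<Rightarrow> nat \<Rightarrow> real \<Rightarrow> (nat \<Rightarrow> real) \<Rightarrow> nat set" where
  "auction_winners B N x c = set_decode (LEAST w. set_decode w \<subseteq> B \<and>
     (\<exists>y. auction_feasible B N (indicator (set_decode w)) y \<and>
          auction_cost B x c (indicator (set_decode w)) y = auction_value B N x c))"

definition auction_payment :: "nat set \<Rightarrow> nat \<Rightarrow> real \<Rightarrow> (nat \<Rightarrow> real) \<Rightarrow> nat \<Rightarrow> real" where
  "auction_payment B N x c s =
     c s * indicator (auction_winners B N x c) s
     + auction_value (B - {s}) N x c - auction_value B N x c"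

(* pool j is the set of carriers who have chosen lane (i, j) in the first stage; those among them
   who bid at most the posted price are counted by low_bids.  A lane stays available until
   low_bids exceeds the number of loads. *)

definition low_bids ::
    "market \<Rightarrow> (lane \<Rightarrow> real) \<Rightarrow> shocks \<Rightarrow> nat \<Rightarrow> (nat \<Rightarrow> nat set) \<Rightarrow> nat \<Rightarrow> nat" where
  "low_bids m p e i pool j = card {s \<in> pool j. cost m e i s j \<le> p (i, j)}"

definition hyb_available ::
    "market \<Rightarrow> (lane \<Rightarrow> real) \<Rightarrow> (lane \<Rightarrow> nat) \<Rightarrow> shocks \<Rightarrow> nat \<Rightarrow> (nat \<Rightarrow> nat set) \<Rightarrow> nat set" where
  "hyb_available m p D e i pool = {j \<in> succs m i. low_bids m p e i pool j \<le> D (i, j)}"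

(* One choice of carrier s.  A carrier whose low bid finds all loads on the chosen lane booked
   closes that lane and, exactly as under posted prices, goes on to choose among the lanes that
   remain; hence the iteration in hyb_pool, in which every repetition closes a lane. *)

definition hyb_choose ::
    "market \<Rightarrow> (lane \<Rightarrow> real) \<Rightarrow> (lane \<Rightarrow> nat) \<Rightarrow> shocks \<Rightarrow> nat \<Rightarrow> nat \<Rightarrow>
     (nat \<Rightarrow> nat set) \<Rightarrow> (nat \<Rightarrow> nat set)" where
  "hyb_choose m p D e i s pool =
     (let A = hyb_available m p D e i pool
      in if A = {} \<or> (\<exists>j\<in>A. s \<in> pool j) then pool
         else let j = best (utility m p e i s) A in pool(j := insert s (pool j)))"

primrec hyb_pool ::
    "market \<Rightarrow> (lane \<Rightarrow> real) \<Rightarrow> (lane \<Rightarrow> nat) \<Rightarrow> shocks \<Rightarrow> nat \<Rightarrow> nat \<Rightarrow> (nat \<Rightarrow> nat set)" where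
  "hyb_pool m p D e i 0 = (\<lambda>_. {})"
| "hyb_pool m p D e i (Suc s) =
     (hyb_choose m p D e i s ^^ card (succs m i)) (hyb_pool m p D e i s)"

definition HYB :: "market \<Rightarrow> (lane \<Rightarrow> real) \<Rightarrow> mechanism" where
  "HYB m p S D e = (\<lambda>(i, j).
     let pool = hyb_pool m p D e i (S i);
         B = pool j;
         x = reserve_price m p (i, j);
         c = (\<lambda>s. cost m e i s j)
     in if low_bids m p e i pool j > D (i, j) then SP m p S D e (i, j)
        else (card (auction_winners B (D (i, j)) x c),
              \<Sum>s\<in>B. auction_payment B (D (i, j)) x c s))"

(* poisson_pmf is specified for positive rates only. *)

definition poisson :: "real \<Rightarrow> nat measure" where
  "poisson a = measure_pmf (if a = 0 then return_pmf 0 else poisson_pmf a)"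

(* The exogenous randomness of one period under shipper prices r: carrier shocks, loads, external
   carrier arrivals, and for every lane l and number y of transporting carriers the number of
   those who stay.  The latter family is independent of everything else, so that evaluating it at
   the random number Y of transporting carriers yields Binomial(Y, q) given Y. *)

type_synonym noise =
  "shocks \<times> (lane \<Rightarrow> nat) \<times> (nat \<Rightarrow> nat) \<times> (lane \<times> nat \<Rightarrow> nat)"

definition noise_space :: "market \<Rightarrow> (lane \<Rightarrow> real) \<Rightarrow> noise measure" where
  "noise_space m r =
     shock_space
     \<Otimes>\<^sub>M Pi\<^sub>M (lanes m) (\<lambda>l. poisson (demand m l (r l)))
     \<Otimes>\<^sub>M Pi\<^sub>M (nodes m) (\<lambda>i. poisson (arrival m i))
     \<Otimes>\<^sub>M Pi\<^sub>M (lanes m \<times> UNIV) (\<lambda>(l, y). measure_pmf (binomial_pmf y (stay m l)))"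

definition path_space :: "market \<Rightarrow> (lane \<Rightarrow> real) \<Rightarrow> (nat \<Rightarrow> noise) measure" where
  "path_space m r = Pi\<^sub>M UNIV (\<lambda>_. noise_space m r)"

definition noise_shocks :: "noise \<Rightarrow> shocks" where
  "noise_shocks = (\<lambda>(e, _, _, _). e)"

definition noise_loads :: "noise \<Rightarrow> lane \<Rightarrow> nat" where
  "noise_loads = (\<lambda>(_, D, _, _). D)"

definition noise_arrivals :: "noise \<Rightarrow> nat \<Rightarrow> nat" where
  "noise_arrivals = (\<lambda>(_, _, L, _). L)"

definition noise_staying :: "noise \<Rightarrow> lane \<times> nat \<Rightarrow> nat" where
  "noise_staying = (\<lambda>(_, _, _, Z). Z)"

(* D0 and S0 are the initial loads and carriers. *)

primrec loads_at :: "(lane \<Rightarrow> nat) \<Rightarrow> (nat \<Rightarrow> noise) \<Rightarrow> nat \<Rightarrow> lane \<Rightarrow> nat" where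
  "loads_at D0 \<omega> 0 = D0"
| "loads_at D0 \<omega> (Suc t) = noise_loads (\<omega> (Suc t))"

primrec carriers_at ::
    "market \<Rightarrow> mechanism \<Rightarrow> (nat \<Rightarrow> nat) \<Rightarrow> (lane \<Rightarrow> nat) \<Rightarrow> (nat \<Rightarrow> noise) \<Rightarrow> nat \<Rightarrow> nat \<Rightarrow> nat" where
  "carriers_at m M S0 D0 \<omega> 0 = S0"
| "carriers_at m M S0 D0 \<omega> (Suc t) = (\<lambda>j.
     (\<Sum>i\<in>preds m j.
        noise_staying (\<omega> t)
          ((i, j), fst (M (carriers_at m M S0 D0 \<omega> t) (loads_at D0 \<omega> t) (noise_shocks (\<omega> t)) (i, j))))
     + noise_arrivals (\<omega> (Suc t)) j)"

definition profit_at ::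
    "market \<Rightarrow> (lane \<Rightarrow> real) \<Rightarrow> mechanism \<Rightarrow> (nat \<Rightarrow> nat) \<Rightarrow> (lane \<Rightarrow> nat) \<Rightarrow>
     nat \<Rightarrow> (nat \<Rightarrow> noise) \<Rightarrow> real" where
  "profit_at m r M S0 D0 t \<omega> =
     (\<Sum>l\<in>lanes m.
        let D = loads_at D0 \<omega> t;
            (Y, P) = M (carriers_at m M S0 D0 \<omega> t) D (noise_shocks (\<omega> t)) l
        in r l * demand m l (r l) - penalty m l * (real (D l) - real Y) - P)"

definition long_run_profit ::
    "market \<Rightarrow> (lane \<Rightarrow> real) \<Rightarrow> mechanism \<Rightarrow> real \<Rightarrow> bool" where
  "long_run_profit m r M g \<longleftrightarrow>
     (\<forall>S0 D0.
        (\<forall>t. integrable (path_space m r) (profit_at m r M S0 D0 t)) \<and>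
        (\<lambda>T. (\<Sum>t<T. integral\<^sup>L (path_space m r) (profit_at m r M S0 D0 t)) / real T)
          \<longlonglongrightarrow> g)"

definition ge_Omega :: "(nat \<Rightarrow> real) \<Rightarrow> (nat \<Rightarrow> real) \<Rightarrow> bool" where
  "ge_Omega f g \<longleftrightarrow> (\<exists>c>0. \<forall>\<^sub>F \<theta> in sequentially. f \<theta> \<ge> c * g \<theta>)"

end

theory Submission
  imports Defs
begin

text \<open>The instance has one node, one lane (its self-loop), and carriers who never stay. From period 1 on
the periods are therefore independent copies of one experiment: \<open>D\<close> loads, Poisson of rate \<open>\<theta>\<close>,
meet \<open>S\<close> carriers, Poisson of rate \<open>2 * \<theta>\<close>, whose costs are i.i.d. logistic with median 1. The
remaining parameters are such that the fluid optimum serves every load with half of the carriers: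
the posted price is the median \<open>p = 1\<close>, the reserve price is \<open>\<xi> = 2\<close>, and the penalty \<open>b = 3 + e\<close> is
the virtual cost at \<open>\<xi>\<close>, so that raising the price towards \<open>\<xi>\<close> to serve more loads pays off on average.

Supply at the price \<open>p\<close> matches demand only on average. With a probability bounded away from 0,
the loads exceed the carriers with cost below \<open>p\<close> by order \<open>sqrt \<theta>\<close>. Posted prices then leave
these loads unserved, although a price higher by order \<open>1 / sqrt \<theta>\<close> would serve them; the
auction finds that price.

To account for the higher payments to the carriers who would have accepted \<open>p\<close>, the gain is split
over the carriers as in Myerson's analysis of auctions. Up to ties, a carrier wins the auction exactly if
his bid lies below a cutoff \<open>\<tau>\<close> that depends on the other bids only, and a winner is paid \<open>\<tau>\<close>
(\<open>auction_winner\<close>, \<open>auction_loser\<close>). If the other low bids leave no load for him, both mechanisms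
treat him alike; otherwise \<open>p \<le> \<tau> \<le> \<xi>\<close>, and averaging over his own cost, with
distribution function \<open>F\<close>, the hybrid mechanism gains \<open>(b - \<tau>) * F \<tau> - (b - p) * F p\<close>, which is at
least \<open>(\<tau> - p) / 6\<close> (\<open>posted_threshold_gain\<close>). Hence the expected gain is nonnegative for every number
of carriers and loads (\<open>expected_hybrid_gain\<close>), and it suffices to find one event of constant
probability on which it has order \<open>sqrt \<theta>\<close>.

That event is \<open>D \<ge> \<theta> + 6 * sqrt \<theta>\<close> and \<open>\<bar>S - 2 * \<theta>\<bar> < 3 * sqrt \<theta>\<close>. By Hoeffding's inequality
fewer than \<open>D\<close> carriers then bid below \<open>p + 1 / sqrt \<theta>\<close> with probability at least one half, in which
case all of the at least \<open>\<theta>\<close> carriers have a cutoff of at least this value (\<open>expected_gain_scarce_carriers\<close>).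
The probability of the event is bounded below by Chebyshev's inequality for \<open>S\<close> and by shifting the
bulk of the Poisson distribution for \<open>D\<close> (\<open>poisson_pmf_upper_deviation\<close>). Finally, the profits lie
between \<open>4 * \<theta>\<close> and \<open>10 * \<theta>\<close>, which turns the absolute gap into the relative one.\<close>

section \<open>The auction as a choice of the largest surpluses\<close>

text \<open>If \<open>a s\<close> is the amount by which the bid of \<open>s\<close> undercuts the reserve price, then buying from a set
of bidders instead of the reserve saves the sum of \<open>a\<close> over that set, so this is the largest saving
that an auction of \<open>N\<close> loads can make.\<close>

definition top_sum :: "nat set \<Rightarrow> nat \<Rightarrow> (nat \<Rightarrow> real) \<Rightarrow> real" where
  "top_sum B N a = Max (sum a ` {W. W \<subseteq> B \<and> card W \<le> N})"

lemma finite_bounded_subsets: "finite B \<Longrightarrow> finite {W. W \<subseteq> B \<and> card W \<le> N}"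
  by (rule finite_subset[of _ "Pow B"]) auto

lemma sum_le_top_sum:
  assumes "finite B" "W \<subseteq> B" "card W \<le> N"
  shows "sum a W \<le> top_sum B N a"
  unfolding top_sum_def using assms by (intro Max_ge) (auto simp: finite_bounded_subsets)

lemma top_sum_attained:
  assumes "finite B"
  obtains W where "W \<subseteq> B" "card W \<le> N" "finite W" "sum a W = top_sum B N a"
proof -
  have "top_sum B N a \<in> sum a ` {W. W \<subseteq> B \<and> card W \<le> N}"
    unfolding top_sum_def using assms
    by (intro Max_in) (auto simp: finite_bounded_subsets intro!: exI[of _ "{}"])
  with assms obtain W where "W \<subseteq> B" "card W \<le> N" "top_sum B N a = sum a W" by auto
  with that[of W] assms finite_subset[of W B] show ?thesis by simp
qed

lemma top_sum_mono:
  assumes "finite B" "N \<le> N'" "B' \<subseteq> B"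
  shows "top_sum B' N a \<le> top_sum B N' a"
proof -
  have "finite B'" using assms finite_subset by blast
  then obtain W where W: "W \<subseteq> B'" "card W \<le> N" "sum a W = top_sum B' N a"
    using top_sum_attained[of B' N a] by metis
  from W show ?thesis using sum_le_top_sum[of B W N' a] assms by auto
qed

lemma top_sum_cong:
  assumes "\<And>s. s \<in> B \<Longrightarrow> a s = a' s"
  shows "top_sum B N a = top_sum B N a'"
proof -
  have "sum a ` {W. W \<subseteq> B \<and> card W \<le> N} = sum a' ` {W. W \<subseteq> B \<and> card W \<le> N}"
    using assms by (intro image_cong refl sum.cong) auto
  then show ?thesis by (simp add: top_sum_def)
qed

text \<open>The linear program of the auction is integral. A best set \<open>W\<close> is separated from the other bidders by
a multiplier \<open>\<mu>\<close> for the number of loads: by exchange, \<open>a\<close> is at least \<open>\<mu>\<close> on \<open>W\<close>, at most \<open>\<mu>\<close>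
off \<open>W\<close>, and \<open>\<mu>\<close> vanishes unless \<open>W\<close> uses up all loads. Weak duality with this \<open>\<mu>\<close> bounds every
fractional allocation.\<close>

lemma fractional_le_top_sum:
  assumes B: "finite B" and A: "\<And>s. s \<in> B \<Longrightarrow> 0 \<le> A s \<and> A s \<le> 1" and N: "sum A B \<le> real N"
  shows "(\<Sum>s\<in>B. a s * A s) \<le> top_sum B N a"
proof -
  obtain W where W: "W \<subseteq> B" "card W \<le> N" "finite W" "sum a W = top_sum B N a"
    using top_sum_attained[OF B] by metis
  have opt: "sum a V \<le> sum a W" if "V \<subseteq> B" "card V \<le> N" for V
    using sum_le_top_sum[OF B that] W by simp
  \<comment> \<open>Otherwise dropping \<open>s\<close> would improve \<open>W\<close>.\<close>
  have in_nonneg: "0 \<le> a s" if "s \<in> W" for s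
  proof -
    have "sum a (W - {s}) \<le> sum a W" using W that by (intro opt) (auto simp: card_Diff_singleton)
    then show ?thesis using W that by (simp add: sum_diff1)
  qed
  obtain \<mu> where \<mu>: "0 \<le> \<mu>" "\<And>s. s \<in> W \<Longrightarrow> \<mu> \<le> a s" "\<And>s. s \<in> B - W \<Longrightarrow> a s \<le> \<mu>"
    "card W = N \<or> \<mu> = 0"
  proof (cases "card W < N")
    case True
    have "a s \<le> 0" if "s \<in> B - W" for s
    proof -
      have "sum a (insert s W) \<le> sum a W" using W that True by (intro opt) auto
      then show ?thesis using W that by simp
    qed
    then show ?thesis using that[of 0] in_nonneg by auto
  next
    case False
    then have cW: "card W = N" using W by simp
    \<comment> \<open>All loads are used up, so only swaps of a member against a non-member are possible.\<close>
    have swap: "a t \<le> a s" if "s \<in> W" "t \<in> B - W" for s t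
    proof -
      have "card (insert t (W - {s})) = card W"
        using W that by (subst card_insert_disjoint) (auto simp: card_Suc_Diff1 simp del: card_Diff_insert)
      then have "sum a (insert t (W - {s})) \<le> sum a W" using W that cW by (intro opt) auto
      then show ?thesis using W that by (simp add: sum_diff1)
    qed
    show ?thesis
      using that[of "Max (insert 0 (a ` (B - W)))"] B cW in_nonneg swap by auto
  qed
  have "(\<Sum>s\<in>B. a s * A s) = (\<Sum>s\<in>B. (a s - \<mu>) * A s) + \<mu> * sum A B"
    by (simp add: sum_distrib_left algebra_simps sum_subtractf)
  also have "(\<Sum>s\<in>B. (a s - \<mu>) * A s) \<le> (\<Sum>s\<in>B. if s \<in> W then a s - \<mu> else 0)"
  proof (rule sum_mono)
    fix s assume s: "s \<in> B"
    show "(a s - \<mu>) * A s \<le> (if s \<in> W then a s - \<mu> else 0)"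
      using A[OF s] \<mu>(2)[of s] \<mu>(3)[of s] s
      by (auto intro: mult_left_le mult_nonpos_nonneg)
  qed
  also have "\<dots> = sum a W - \<mu> * real (card W)"
    using W B by (simp add: sum.If_cases Int_absorb1 sum_subtractf)
  also have "\<mu> * sum A B \<le> \<mu> * real N" using \<mu>(1) N by (rule mult_left_mono[rotated])
  finally show ?thesis using \<mu>(4) W by auto
qed

lemma auction_cost_eq:
  assumes "auction_feasible B N A y"
  shows "auction_cost B x c A y = x * real N - (\<Sum>s\<in>B. (x - c s) * A s)"
proof -
  have y: "y = real N - sum A B" using assms by (simp add: auction_feasible_def)
  show ?thesis
    by (simp add: y auction_cost_def algebra_simps sum_subtractf sum_distrib_left)
qed

lemma auction_feasible_indicator:
  assumes "finite B" "W \<subseteq> B"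
  shows "auction_feasible B N (indicator W) y \<longleftrightarrow> card W \<le> N \<and> y = real N - real (card W)"
proof -
  have "sum (indicator W) B = real (card W)"
    using assms by (simp add: indicator_def sum.If_cases Int_absorb1)
  then show ?thesis by (auto simp: auction_feasible_def indicator_def)
qed

lemma sum_mult_indicator_subset:
  fixes f :: "nat \<Rightarrow> real"
  assumes "finite B" "W \<subseteq> B"
  shows "(\<Sum>s\<in>B. f s * indicator W s) = sum f W"
  using assms by (simp add: indicator_def sum.If_cases Int_absorb1)

lemma auction_value_eq:
  assumes B: "finite B"
  shows "auction_value B N x c = x * real N - top_sum B N (\<lambda>s. x - c s)"
  unfolding auction_value_def
proof (rule cInf_eq_minimum)
  obtain W where W: "W \<subseteq> B" "card W \<le> N" "finite W"
      "sum (\<lambda>s. x - c s) W = top_sum B N (\<lambda>s. x - c s)"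
    using top_sum_attained[OF B] by metis
  have f: "auction_feasible B N (indicator W) (real N - real (card W))"
    using auction_feasible_indicator[OF B W(1)] W by auto
  have "auction_cost B x c (indicator W) (real N - real (card W)) =
      x * real N - top_sum B N (\<lambda>s. x - c s)"
    using auction_cost_eq[OF f, of x c] sum_mult_indicator_subset[OF B W(1), of "\<lambda>s. x - c s"] W(4)
    by (simp only:)
  with f show "x * real N - top_sum B N (\<lambda>s. x - c s) \<in>
      {auction_cost B x c A y |A y. auction_feasible B N A y}"
    by (metis (mono_tags, lifting) mem_Collect_eq)
next
  fix z assume "z \<in> {auction_cost B x c A y |A y. auction_feasible B N A y}"
  then obtain A y where z: "z = auction_cost B x c A y" and f: "auction_feasible B N A y" by auto
  have "(\<Sum>s\<in>B. (x - c s) * A s) \<le> top_sum B N (\<lambda>s. x - c s)"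
    using f by (intro fractional_le_top_sum B) (auto simp: auction_feasible_def)
  then show "x * real N - top_sum B N (\<lambda>s. x - c s) \<le> z"
    by (simp add: z auction_cost_eq[OF f])
qed

text \<open>Describing the optimal sets through the finite maximum instead of the infimum over fractional
allocations makes the winners visibly a measurable function of the bids.\<close>

lemma auction_winners_eq:
  assumes B: "finite B"
  shows "auction_winners B N x c = set_decode (LEAST w. set_decode w \<subseteq> B \<and>
     card (set_decode w) \<le> N \<and> sum (\<lambda>s. x - c s) (set_decode w) = top_sum B N (\<lambda>s. x - c s))"
proof -
  have "(\<exists>y. auction_feasible B N (indicator W) y \<and>
      auction_cost B x c (indicator W) y = auction_value B N x c) \<longleftrightarrow>
    card W \<le> N \<and> sum (\<lambda>s. x - c s) W = top_sum B N (\<lambda>s. x - c s)" (is "?L \<longleftrightarrow> ?R")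
    if W: "W \<subseteq> B" for W
  proof -
    have "?L \<longleftrightarrow> (\<exists>y. auction_feasible B N (indicator W) y \<and>
        x * real N - sum (\<lambda>s. x - c s) W = auction_value B N x c)"
      using auction_cost_eq[of B N "indicator W" _ x c] sum_mult_indicator_subset[OF B W, of "\<lambda>s. x - c s"]
      by (intro ex_cong1) auto
    also have "\<dots> \<longleftrightarrow> ?R"
      using auction_feasible_indicator[OF B W] B by (auto simp: auction_value_eq)
    finally show ?thesis .
  qed
  then show ?thesis unfolding auction_winners_def by (intro arg_cong[where f=set_decode]) meson
qed

lemma auction_winners_optimal:
  assumes B: "finite B"
  shows "auction_winners B N x c \<subseteq> B" "card (auction_winners B N x c) \<le> N"
    "sum (\<lambda>s. x - c s) (auction_winners B N x c) = top_sum B N (\<lambda>s. x - c s)"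
proof -
  obtain W where W: "W \<subseteq> B" "card W \<le> N" "finite W"
      "sum (\<lambda>s. x - c s) W = top_sum B N (\<lambda>s. x - c s)"
    using top_sum_attained[OF B] by metis
  let ?P = "\<lambda>w. set_decode w \<subseteq> B \<and>
     card (set_decode w) \<le> N \<and> sum (\<lambda>s. x - c s) (set_decode w) = top_sum B N (\<lambda>s. x - c s)"
  have "?P (set_encode W)" using W by simp
  from LeastI[of ?P, OF this]
  show "auction_winners B N x c \<subseteq> B" "card (auction_winners B N x c) \<le> N"
    "sum (\<lambda>s. x - c s) (auction_winners B N x c) = top_sum B N (\<lambda>s. x - c s)"
    unfolding auction_winners_eq[OF B] by auto
qed

text \<open>The difference of the two sums is the \<open>N\<close>-th largest surplus among the competitors of \<open>s\<close>, or 0 if it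
is negative, so the cutoff is the smaller of the reserve price and the \<open>N\<close>-th lowest competing bid.
Writing it with sums rather than order statistics fits the payment rule and gives measurability. For
\<open>N = 0\<close> truncated subtraction makes the cutoff equal to the reserve price.\<close>

definition cutoff :: "nat set \<Rightarrow> nat \<Rightarrow> real \<Rightarrow> (nat \<Rightarrow> real) \<Rightarrow> nat \<Rightarrow> real" where
  "cutoff B N x c s = x - (top_sum (B - {s}) N (\<lambda>t. x - c t) - top_sum (B - {s}) (N - 1) (\<lambda>t. x - c t))"

lemma cutoff_le_reserve: "finite B \<Longrightarrow> cutoff B N x c s \<le> x"
  using top_sum_mono[of "B - {s}" "N - 1" N "B - {s}"] by (simp add: cutoff_def)

lemma cutoff_cong:
  assumes "\<And>t. t \<in> B - {s} \<Longrightarrow> c t = c' t"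
  shows "cutoff B N x c s = cutoff B N x c' s"
  unfolding cutoff_def using assms
  by (intro arg_cong2[where f="(-)"] refl top_sum_cong) auto

text \<open>A best choice of \<open>N\<close> competitors must contain one bidding at least \<open>z\<close>; dropping it loses at most
\<open>x - z\<close>.\<close>

lemma cutoff_ge:
  assumes B: "finite B" and few: "card {t\<in>B - {s}. c t < z} < N" and z: "z \<le> x"
  shows "z \<le> cutoff B N x c s"
proof -
  let ?a = "\<lambda>t. x - c t" and ?B = "B - {s}"
  obtain W where W: "W \<subseteq> ?B" "card W \<le> N" "finite W" "sum ?a W = top_sum ?B N ?a"
    using top_sum_attained[of ?B N ?a] B by auto
  have "top_sum ?B N ?a - top_sum ?B (N - 1) ?a \<le> x - z"
  proof (cases "card W = N")
    case False
    then have "sum ?a W \<le> top_sum ?B (N - 1) ?a" using W B by (intro sum_le_top_sum) auto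
    then show ?thesis using W z by simp
  next
    case True
    have "\<not> W \<subseteq> {t\<in>?B. c t < z}" using card_mono[of "{t\<in>?B. c t < z}" W] B few True by auto
    then obtain t where t: "t \<in> W" "z \<le> c t" using W(1) by (force simp: not_less)
    have "sum ?a (W - {t}) \<le> top_sum ?B (N - 1) ?a"
      using W B t True by (intro sum_le_top_sum) auto
    then show ?thesis using W t by (simp add: sum_diff1)
  qed
  then show ?thesis by (simp add: cutoff_def)
qed

text \<open>A best choice of \<open>N - 1\<close> competitors leaves out one bidding at most \<open>z\<close>; adding it gains at least
\<open>x - z\<close>.\<close>

lemma cutoff_le:
  assumes B: "finite B" and many: "N \<le> card {t\<in>B - {s}. c t \<le> z}" and N: "0 < N"
  shows "cutoff B N x c s \<le> z"
proof -
  let ?a = "\<lambda>t. x - c t" and ?B = "B - {s}"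
  obtain W where W: "W \<subseteq> ?B" "card W \<le> N - 1" "finite W" "sum ?a W = top_sum ?B (N - 1) ?a"
    using top_sum_attained[of ?B "N - 1" ?a] B by auto
  have "\<not> {t\<in>?B. c t \<le> z} \<subseteq> W" using card_mono[of W "{t\<in>?B. c t \<le> z}"] W many N by auto
  then obtain t where t: "t \<in> ?B - W" "c t \<le> z" by auto
  have "sum ?a (insert t W) \<le> top_sum ?B N ?a"
    using W B t N by (intro sum_le_top_sum) (auto simp: card_insert_if)
  then show ?thesis using W t by (simp add: cutoff_def)
qed

lemma top_sum_add_bidder:
  assumes B: "finite B" and s: "s \<in> B" and N: "0 < N"
  shows "a s + top_sum (B - {s}) (N - 1) a \<le> top_sum B N a"
proof -
  obtain W where W: "W \<subseteq> B - {s}" "card W \<le> N - 1" "finite W" "sum a W = top_sum (B - {s}) (N - 1) a"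
    using top_sum_attained[of "B - {s}" "N - 1" a] B by auto
  have "sum a (insert s W) \<le> top_sum B N a"
    using W B s N by (intro sum_le_top_sum) (auto simp: card_insert_if)
  then show ?thesis using W by (subst (asm) sum.insert) auto
qed

text \<open>A winner takes one of the \<open>N\<close> loads away from his competitors, so the saving with him is his own
surplus plus the best saving of the others on \<open>N - 1\<close> loads. The payment rule charges exactly this
externality, which is the cutoff. The saving with him is no less than without him; this bounds his
bid.\<close>

lemma auction_winner:
  assumes B: "finite B" and s: "s \<in> auction_winners B N x c"
  shows "auction_payment B N x c s = cutoff B N x c s" "c s \<le> cutoff B N x c s" "0 < N"
proof -
  let ?a = "\<lambda>t. x - c t" and ?W = "auction_winners B N x c"
  note W = auction_winners_optimal[OF B, where N=N and x=x and c=c]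
  have fin: "finite ?W" using W(1) B finite_subset by blast
  have "0 < card ?W" using s fin card_gt_0_iff by blast
  then show N: "0 < N" using W(2) by simp
  have "sum ?a (?W - {s}) \<le> top_sum (B - {s}) (N - 1) ?a"
    using W B s fin by (intro sum_le_top_sum) auto
  moreover have "?a s + top_sum (B - {s}) (N - 1) ?a \<le> top_sum B N ?a"
    using W s by (intro top_sum_add_bidder B N) auto
  ultimately have eq: "top_sum B N ?a = ?a s + top_sum (B - {s}) (N - 1) ?a"
    using W(3) s fin by (simp add: sum_diff1)
  then show pay: "auction_payment B N x c s = cutoff B N x c s"
    using s B by (simp add: auction_payment_def auction_value_eq cutoff_def)
  have "top_sum (B - {s}) N ?a \<le> top_sum B N ?a" using B by (intro top_sum_mono) auto
  then show "c s \<le> cutoff B N x c s" using eq by (simp add: cutoff_def)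
qed

text \<open>The winning set remains available when a loser is removed, so the auction value does not change and
he is paid nothing; had his bid been below the cutoff, replacing a competitor by him would have
saved more.\<close>

lemma auction_loser:
  assumes B: "finite B" and s: "s \<notin> auction_winners B N x c"
  shows "auction_payment B N x c s = 0" "s \<in> B \<Longrightarrow> 0 < N \<Longrightarrow> cutoff B N x c s \<le> c s"
proof -
  let ?a = "\<lambda>t. x - c t" and ?W = "auction_winners B N x c"
  note W = auction_winners_optimal[OF B, where N=N and x=x and c=c]
  have "sum ?a ?W \<le> top_sum (B - {s}) N ?a"
    using W B s by (intro sum_le_top_sum) auto
  moreover have "top_sum (B - {s}) N ?a \<le> top_sum B N ?a" using B by (intro top_sum_mono) auto
  ultimately have eq: "top_sum B N ?a = top_sum (B - {s}) N ?a" using W(3) by simp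
  then show "auction_payment B N x c s = 0"
    using s B by (simp add: auction_payment_def auction_value_eq)
  show "cutoff B N x c s \<le> c s" if "s \<in> B" "0 < N"
    using top_sum_add_bidder[OF B that, of ?a] eq by (simp add: cutoff_def)
qed

section \<open>Both mechanisms on a single lane\<close>

lemma best_outside_or_lane:
  assumes "0 < j"
  shows "best u {0, j} = (if u 0 < u j then j else 0)"
proof (cases "u 0 < u j")
  case True
  then have "best u {0, j} = j" unfolding best_def by (intro Least_equality) auto
  with True show ?thesis by simp
next
  case False
  then have "best u {0, j} = 0" unfolding best_def by (intro Least_equality) auto
  with False show ?thesis by simp
qed

lemma best_singleton: "best u {j} = j"
  unfolding best_def by (rule Least_equality) auto

lemma lane_preferred_iff_cost_below_price:
  assumes "0 < j" "0 < sensitivity m"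
  shows "utility m p e i s 0 < utility m p e i s j \<longleftrightarrow> cost m e i s j < p (i, j)"
  using assms by (auto simp: utility_def cost_def field_simps)

lemma card_filter_lessThan_Suc:
  "card {t. t < Suc s \<and> P t} = card {t. t < s \<and> P t} + of_bool (P s)"
proof -
  have "{t. t < Suc s \<and> P t} = (if P s then insert s {t. t < s \<and> P t} else {t. t < s \<and> P t})"
    by (auto simp: less_Suc_eq)
  then show ?thesis by simp
qed

lemma sp_booked_single_lane:
  assumes "succs m i = {j}" "0 < j" "0 < sensitivity m"
  shows "sp_booked m p D e i s j = min (D (i, j)) (card {t\<in>{..<s}. cost m e i t j < p (i, j)})"
proof (induction s)
  case (Suc s)
  let ?x = "sp_booked m p D e i s"
  have "sp_booked m p D e i (Suc s) j =
      ?x j + of_bool (?x j < D (i, j) \<and> cost m e i s j < p (i, j))"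
  proof (cases "?x j < D (i, j)")
    case True
    then have "{j \<in> succs m i. ?x j < D (i, j)} = {j}" using assms by auto
    then show ?thesis
      using assms True by (simp add: Let_def best_outside_or_lane lane_preferred_iff_cost_below_price)
  next
    case False
    then have "{j \<in> succs m i. ?x j < D (i, j)} = {}" using assms by auto
    then have "best (utility m p e i s) (insert 0 {j \<in> succs m i. ?x j < D (i, j)}) = 0"
      by (simp only: best_singleton)
    then show ?thesis using False by (simp add: Let_def)
  qed
  then show ?case by (simp add: Suc card_filter_lessThan_Suc del: sp_booked.simps)
qed simp

text \<open>The carriers and loads enter the outcome of a period on a single lane only through their numbers
\<open>n\<close> and \<open>d\<close> and the costs \<open>c\<close>; the outcome is the pair of the loads transported and the payment.\<close>

definition sp_outcome :: "real \<Rightarrow> nat \<Rightarrow> nat \<Rightarrow> (nat \<Rightarrow> real) \<Rightarrow> nat \<times> real" where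
  "sp_outcome p n d c = (let x = min d (card {s\<in>{..<n}. c s < p}) in (x, p * real x))"

definition hyb_outcome :: "real \<Rightarrow> real \<Rightarrow> nat \<Rightarrow> nat \<Rightarrow> (nat \<Rightarrow> real) \<Rightarrow> nat \<times> real" where
  "hyb_outcome p x n d c =
     (if d < card {s\<in>{..<n}. c s \<le> p} then sp_outcome p n d c
      else (card (auction_winners {..<n} d x c), \<Sum>s<n. auction_payment {..<n} d x c s))"

lemma SP_single_lane:
  assumes "succs m i = {j}" "0 < j" "0 < sensitivity m"
  shows "SP m p S D e (i, j) = sp_outcome (p (i, j)) (S i) (D (i, j)) (\<lambda>s. cost m e i s j)"
  using assms by (simp add: SP_def sp_outcome_def sp_booked_single_lane Let_def)

lemma hyb_choose_single_lane:
  assumes "succs m i = {j}"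
  shows "hyb_choose m p D e i s pool =
    (if low_bids m p e i pool j \<le> D (i, j) \<and> s \<notin> pool j then pool(j := insert s (pool j)) else pool)"
proof (cases "low_bids m p e i pool j \<le> D (i, j)")
  case True
  then have "hyb_available m p D e i pool = {j}" using assms by (auto simp: hyb_available_def)
  then show ?thesis using True by (simp add: hyb_choose_def best_singleton)
next
  case False
  then have "hyb_available m p D e i pool = {}" using assms by (auto simp: hyb_available_def)
  then show ?thesis using False by (simp add: hyb_choose_def)
qed

text \<open>With a single lane, every carrier joins the pool as long as the lane is open; once the low bids
exceed the loads, the pool no longer changes. Hence the sequential rule compares the loads with the
low bids among all carriers.\<close>

lemma hyb_pool_single_lane:
  fixes m p D e i j
  assumes "succs m i = {j}"
  defines "low s \<equiv> card {t\<in>{..<s}. cost m e i t j \<le> p (i, j)}"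
  shows "(low s \<le> D (i, j) \<longrightarrow> hyb_pool m p D e i s j = {..<s}) \<and>
         (D (i, j) < low s \<longrightarrow> D (i, j) < low_bids m p e i (hyb_pool m p D e i s) j)"
proof (induction s)
  case 0
  then show ?case by (simp add: low_def)
next
  case (Suc s)
  let ?pool = "hyb_pool m p D e i s" and ?pool' = "hyb_pool m p D e i (Suc s)"
  have step: "?pool' = hyb_choose m p D e i s ?pool" using assms by simp
  have mono: "low s \<le> low (Suc s)" by (simp add: low_def card_filter_lessThan_Suc)
  show ?case
  proof (cases "low s \<le> D (i, j)")
    case True
    then have pool: "?pool j = {..<s}" using Suc by simp
    then have "low_bids m p e i ?pool j = low s" by (simp add: low_bids_def low_def)
    then have pool': "?pool' j = {..<Suc s}"
      using True pool unfolding step by (simp add: hyb_choose_single_lane[OF assms(1)] lessThan_Suc)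
    then have "low_bids m p e i ?pool' j = low (Suc s)" by (simp only: low_bids_def low_def)
    with pool' show ?thesis by simp
  next
    case False
    then have full: "D (i, j) < low_bids m p e i ?pool j" using Suc by simp
    then have "?pool' = ?pool" unfolding step by (simp add: hyb_choose_single_lane[OF assms(1)])
    then show ?thesis using full False mono by simp
  qed
qed

lemma HYB_single_lane:
  assumes "succs m i = {j}" "0 < j" "0 < sensitivity m"
  shows "HYB m p S D e (i, j) =
    hyb_outcome (p (i, j)) (reserve_price m p (i, j)) (S i) (D (i, j)) (\<lambda>s. cost m e i s j)"
proof (cases "D (i, j) < card {t\<in>{..<S i}. cost m e i t j \<le> p (i, j)}")
  case True
  then show ?thesis
    using hyb_pool_single_lane[OF assms(1), where e=e and p=p and s="S i" and D=D]
    by (simp add: HYB_def hyb_outcome_def SP_single_lane[OF assms] Let_def)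
next
  case False
  then have "hyb_pool m p D e i (S i) j = {..<S i}"
    using hyb_pool_single_lane[OF assms(1), where e=e and p=p and s="S i" and D=D] by simp
  moreover from this False
  have "\<not> D (i, j) < low_bids m p e i (hyb_pool m p D e i (S i)) j"
    by (simp add: low_bids_def)
  ultimately show ?thesis using False by (simp add: HYB_def hyb_outcome_def Let_def)
qed

lemma real_card_filter:
  "finite B \<Longrightarrow> real (card {s\<in>B. P s}) = (\<Sum>s\<in>B. of_bool (P s))"
  by (simp add: sum.If_cases of_bool_def Int_def conj_commute)

lemma card_filter_remove:
  assumes "finite B" "s \<in> B"
  shows "card {t\<in>B. P t} = card {t\<in>B - {s}. P t} + of_bool (P s)"
proof -
  have "{t\<in>B. P t} = (if P s then insert s {t\<in>B - {s}. P t} else {t\<in>B - {s}. P t})"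
    using assms by auto
  then show ?thesis using assms by simp
qed

lemma sum_auction_payments:
  assumes "finite B"
  shows "(\<Sum>s\<in>B. auction_payment B d x c s) = (\<Sum>s\<in>auction_winners B d x c. cutoff B d x c s)"
proof -
  have "auction_payment B d x c s = (if s \<in> auction_winners B d x c then cutoff B d x c s else 0)" for s
    using auction_winner(1)[OF assms] auction_loser(1)[OF assms] by auto
  then show ?thesis
    using assms auction_winners_optimal(1)[OF assms, of d x c]
    by (simp add: sum.If_cases Int_absorb1)
qed

text \<open>A winner with a low bid has fewer than \<open>d\<close> competitors below \<open>p\<close>, and any other winner has a cutoff
at least his own bid, which exceeds \<open>p\<close>.\<close>

lemma cutoff_of_winner_ge_price:
  assumes few: "card {s\<in>{..<n}. c s \<le> p} \<le> d" and px: "p \<le> x"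
    and s: "s \<in> auction_winners {..<n} d x c"
  shows "p \<le> cutoff {..<n} d x c s"
proof -
  have sn: "s \<in> {..<n}" using s auction_winners_optimal(1)[of "{..<n}"] by blast
  note w = auction_winner[OF finite_lessThan s]
  show ?thesis
  proof (cases "c s \<le> p")
    case True
    then have "card {t\<in>{..<n} - {s}. c t \<le> p} < d"
      using few card_filter_remove[OF _ sn, of "\<lambda>t. c t \<le> p"] by simp
    moreover have "card {t\<in>{..<n} - {s}. c t < p} \<le> card {t\<in>{..<n} - {s}. c t \<le> p}"
      by (intro card_mono) auto
    ultimately show ?thesis using px by (intro cutoff_ge) auto
  qed (use w in simp)
qed

lemma hyb_outcome_bounds:
  assumes "0 \<le> p" "p \<le> x"
  shows "fst (hyb_outcome p x n d c) \<le> d" "0 \<le> snd (hyb_outcome p x n d c)"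
    "snd (hyb_outcome p x n d c) \<le> x * real (fst (hyb_outcome p x n d c))"
proof -
  let ?W = "auction_winners {..<n} d x c"
  have "fst (hyb_outcome p x n d c) \<le> d \<and> 0 \<le> snd (hyb_outcome p x n d c) \<and>
    snd (hyb_outcome p x n d c) \<le> x * real (fst (hyb_outcome p x n d c))"
  proof (cases "d < card {s\<in>{..<n}. c s \<le> p}")
    case True
    then show ?thesis
      using assms by (auto simp: hyb_outcome_def sp_outcome_def Let_def intro: mult_right_mono)
  next
    case False
    have "sum (cutoff {..<n} d x c) ?W \<le> real (card ?W) * x"
      by (intro sum_bounded_above cutoff_le_reserve) auto
    moreover have "0 \<le> sum (cutoff {..<n} d x c) ?W"
      using False assms cutoff_of_winner_ge_price[of n c p d x] by (intro sum_nonneg) force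
    ultimately show ?thesis
      using False auction_winners_optimal(2)[of "{..<n}" d x c]
      by (simp add: hyb_outcome_def sum_auction_payments mult.commute)
  qed
  then show "fst (hyb_outcome p x n d c) \<le> d" "0 \<le> snd (hyb_outcome p x n d c)"
    "snd (hyb_outcome p x n d c) \<le> x * real (fst (hyb_outcome p x n d c))" by auto
qed

section \<open>The gain of the hybrid mechanism, carrier by carrier\<close>

text \<open>The part of the profit of a period that depends on the mechanism: the penalties avoided by
transporting loads, less the payment.\<close>

definition surplus :: "real \<Rightarrow> nat \<times> real \<Rightarrow> real" where
  "surplus b z = b * real (fst z) - snd z"

text \<open>The contribution of carrier \<open>s\<close> to the gain of the hybrid mechanism, in a form in which his own cost
appears only in the two comparisons with the cutoff and the posted price.\<close>

definition cutoff_gain :: "real \<Rightarrow> real \<Rightarrow> real \<Rightarrow> nat \<Rightarrow> nat \<Rightarrow> (nat \<Rightarrow> real) \<Rightarrow> nat \<Rightarrow> real" where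
  "cutoff_gain b p x n d c s =
     (if card {t\<in>{..<n} - {s}. c t < p} < d
      then (b - cutoff {..<n} d x c s) * of_bool (c s < cutoff {..<n} d x c s)
           - (b - p) * of_bool (c s < p)
      else 0)"

text \<open>Both mechanisms agree if the low bids exceed the loads, and then every carrier has at least \<open>d\<close>
low-bidding competitors. Otherwise both surpluses split over the carriers who are served. A carrier
with at least \<open>d\<close> low-bidding competitors has a high bid himself and a cutoff of at most \<open>p\<close>, so
neither mechanism serves him; without loads nobody is served at all.\<close>

lemma hybrid_gain_eq_sum_cutoff_gain:
  assumes px: "p \<le> x"
    and no_ties: "\<And>s. s < n \<Longrightarrow> c s \<noteq> p \<and> c s \<noteq> cutoff {..<n} d x c s"
  shows "surplus b (hyb_outcome p x n d c) - surplus b (sp_outcome p n d c) =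
    (\<Sum>s<n. cutoff_gain b p x n d c s)"
proof -
  let ?W = "auction_winners {..<n} d x c" and ?\<tau> = "cutoff {..<n} d x c"
  let ?X = "card {s\<in>{..<n}. c s < p}"
  have "{s\<in>{..<n}. c s \<le> p} = {s\<in>{..<n}. c s < p}"
    using no_ties by (auto simp: order_less_le)
  then have X: "card {s\<in>{..<n}. c s \<le> p} = ?X" by simp
  have rm: "?X = card {t\<in>{..<n} - {s}. c t < p} + of_bool (c s < p)" if "s < n" for s
    using that by (intro card_filter_remove) auto
  show ?thesis
  proof (cases "d < ?X")
    case True
    then have "cutoff_gain b p x n d c s = 0" if "s < n" for s
      using rm[OF that] by (auto simp: cutoff_gain_def)
    then show ?thesis using True X by (simp add: hyb_outcome_def)
  next
    case False
    have W: "?W \<subseteq> {..<n}" using auction_winners_optimal(1)[of "{..<n}"] by simp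
    have "surplus b (hyb_outcome p x n d c) = (\<Sum>s\<in>?W. b - ?\<tau> s)"
      using False X by (simp add: surplus_def hyb_outcome_def sum_auction_payments sum_subtractf)
    also have "\<dots> = (\<Sum>s<n. (b - ?\<tau> s) * of_bool (s \<in> ?W))"
      using sum_mult_indicator_subset[OF finite_lessThan W, of "\<lambda>s. b - ?\<tau> s"]
      by (simp only: indicator_def)
    finally have H: "surplus b (hyb_outcome p x n d c) = (\<Sum>s<n. (b - ?\<tau> s) * of_bool (s \<in> ?W))" .
    have "surplus b (sp_outcome p n d c) = (b - p) * real ?X"
      using False by (simp add: surplus_def sp_outcome_def Let_def min_def left_diff_distrib)
    also have "\<dots> = (\<Sum>s<n. (b - p) * of_bool (c s < p))"
      unfolding real_card_filter[OF finite_lessThan] sum_distrib_left ..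
    finally have S: "surplus b (sp_outcome p n d c) = (\<Sum>s<n. (b - p) * of_bool (c s < p))" .
    have "(b - ?\<tau> s) * of_bool (s \<in> ?W) - (b - p) * of_bool (c s < p) = cutoff_gain b p x n d c s"
      if s: "s < n" for s
    proof (cases "d = 0")
      case True
      then have "s \<notin> ?W" using auction_winner(3)[of "{..<n}" s d x c] by auto
      moreover have "\<not> c s < p" using rm[OF s] False True by (cases "c s < p") auto
      ultimately show ?thesis using True by (simp add: cutoff_gain_def)
    next
      case d: False
      have win: "s \<in> ?W \<longleftrightarrow> c s < ?\<tau> s"
        using auction_winner(2)[of "{..<n}" s d x c] auction_loser(2)[of "{..<n}" s d x c]
          no_ties[OF s] s d by force
      show ?thesis
      proof (cases "card {t\<in>{..<n} - {s}. c t < p} < d")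
        case True
        then show ?thesis by (simp add: cutoff_gain_def win)
      next
        case many: False
        then have hi: "\<not> c s < p" using rm[OF s] False by (cases "c s < p") auto
        have "card {t\<in>{..<n} - {s}. c t < p} \<le> card {t\<in>{..<n} - {s}. c t \<le> p}"
          by (intro card_mono) auto
        then have "?\<tau> s \<le> p" using many d by (intro cutoff_le) auto
        then show ?thesis using hi many by (simp add: cutoff_gain_def win)
      qed
    qed
    then show ?thesis unfolding H S sum_subtractf[symmetric] by (intro sum.cong) auto
  qed
qed

section \<open>Measurability of the outcomes\<close>

lemma measurable_top_sum [measurable]:
  assumes "finite B" and [measurable]: "\<And>s. (\<lambda>\<omega>. a \<omega> s) \<in> borel_measurable M"
  shows "(\<lambda>\<omega>. top_sum B N (a \<omega>)) \<in> borel_measurable M"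
proof -
  have "(\<lambda>\<omega>. Max ((\<lambda>W. sum (a \<omega>) W) ` {W. W \<subseteq> B \<and> card W \<le> N})) \<in> borel_measurable M"
    using assms(1) by (intro borel_measurable_Max finite_bounded_subsets borel_measurable_sum assms(2))
  then show ?thesis by (simp add: top_sum_def)
qed

lemma measurable_cutoff [measurable]:
  assumes "finite B" and [measurable]: "\<And>s. (\<lambda>\<omega>. c \<omega> s) \<in> borel_measurable M"
  shows "(\<lambda>\<omega>. cutoff B N x (c \<omega>) s) \<in> borel_measurable M"
  unfolding cutoff_def using assms(1) by (intro borel_measurable_diff borel_measurable_const measurable_top_sum) auto

lemma measurable_auction_winners:
  assumes B: "finite B" and c [measurable]: "\<And>s. (\<lambda>\<omega>. c \<omega> s) \<in> borel_measurable M"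
  shows "(\<lambda>\<omega>. f (auction_winners B N x (c \<omega>))) \<in> M \<rightarrow>\<^sub>M count_space UNIV"
proof -
  have [measurable]: "(\<lambda>\<omega>. top_sum B N (\<lambda>s. x - c \<omega> s)) \<in> borel_measurable M"
    using B by (intro measurable_top_sum) auto
  have "(\<lambda>\<omega>. LEAST w. set_decode w \<subseteq> B \<and> card (set_decode w) \<le> N \<and>
      sum (\<lambda>s. x - c \<omega> s) (set_decode w) = top_sum B N (\<lambda>s. x - c \<omega> s)) \<in> M \<rightarrow>\<^sub>M count_space UNIV"
    by measurable
  from measurable_compose[OF this measurable_count_space, of "\<lambda>w. f (set_decode w)"]
  show ?thesis unfolding auction_winners_eq[OF B] .
qed

lemma measurable_auction_payment [measurable]:
  assumes B: "finite B" and c [measurable]: "\<And>s. (\<lambda>\<omega>. c \<omega> s) \<in> borel_measurable M"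
  shows "(\<lambda>\<omega>. auction_payment B N x (c \<omega>) s) \<in> borel_measurable M"
proof -
  have [measurable]: "(\<lambda>\<omega>. s \<in> auction_winners B N x (c \<omega>)) \<in> M \<rightarrow>\<^sub>M count_space UNIV"
    by (rule measurable_auction_winners[OF B c, where f="\<lambda>W. s \<in> W"])
  have [measurable]: "(\<lambda>\<omega>. top_sum B' N (\<lambda>s. x - c \<omega> s)) \<in> borel_measurable M" if "finite B'" for B'
    using that by (intro measurable_top_sum) auto
  show ?thesis
    using B unfolding auction_payment_def indicator_def by (simp add: auction_value_eq)
qed

lemma measurable_card_filter [measurable]:
  assumes B: "finite B" and [measurable]: "\<And>s. Measurable.pred M (\<lambda>\<omega>. P \<omega> s)"
  shows "(\<lambda>\<omega>. card {s\<in>B. P \<omega> s}) \<in> M \<rightarrow>\<^sub>M count_space UNIV"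
proof -
  have "card {s\<in>B. P \<omega> s} = (\<Sum>s\<in>B. if P \<omega> s then 1 else 0)" for \<omega>
    using B by (simp add: sum.If_cases Int_def)
  then show ?thesis by simp
qed

lemma measurable_sp_outcome:
  assumes c [measurable]: "\<And>s. (\<lambda>\<omega>. c \<omega> s) \<in> borel_measurable M"
  shows "(\<lambda>\<omega>. fst (sp_outcome p n d (c \<omega>))) \<in> M \<rightarrow>\<^sub>M count_space UNIV"
    "(\<lambda>\<omega>. snd (sp_outcome p n d (c \<omega>))) \<in> borel_measurable M"
  unfolding sp_outcome_def Let_def by (simp_all) measurable

lemma measurable_hyb_outcome:
  assumes c [measurable]: "\<And>s. (\<lambda>\<omega>. c \<omega> s) \<in> borel_measurable M"
  shows "(\<lambda>\<omega>. fst (hyb_outcome p x n d (c \<omega>))) \<in> M \<rightarrow>\<^sub>M count_space UNIV"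
    "(\<lambda>\<omega>. snd (hyb_outcome p x n d (c \<omega>))) \<in> borel_measurable M"
proof -
  note [measurable] = measurable_sp_outcome[of c M p n d, OF c]
    measurable_auction_winners[OF finite_lessThan[of n] c, where f=card]
  have [measurable]: "Measurable.pred M (\<lambda>\<omega>. d < card {s\<in>{..<n}. c \<omega> s \<le> p})"
    by measurable
  show "(\<lambda>\<omega>. fst (hyb_outcome p x n d (c \<omega>))) \<in> M \<rightarrow>\<^sub>M count_space UNIV"
    unfolding hyb_outcome_def if_distrib[of fst] fst_conv by measurable
  show "(\<lambda>\<omega>. snd (hyb_outcome p x n d (c \<omega>))) \<in> borel_measurable M"
    unfolding hyb_outcome_def if_distrib[of snd] snd_conv by measurable
qed

section \<open>Logistic opportunity costs\<close>

lemma tendsto_gumbel_antiderivative: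
  fixes k :: real
  assumes "0 < k"
  shows "((\<lambda>x. - exp (- k * exp x) / k) \<longlongrightarrow> 0) at_top"
proof -
  have "filterlim (\<lambda>x. k * exp x) at_top at_top"
    by (rule filterlim_tendsto_pos_mult_at_top[OF tendsto_const assms exp_at_top])
  then have "((\<lambda>x. exp (- (k * exp x))) \<longlongrightarrow> 0) at_top"
    by (intro filterlim_compose[OF exp_at_bot]) (simp add: filterlim_uminus_at_bot)
  from tendsto_divide[OF tendsto_minus[OF this] tendsto_const, of k] assms
  show ?thesis by simp
qed

text \<open>The integrand is the derivative of \<open>\<lambda>x. exp (- k * exp (- x)) / k\<close>; the reflection of the line serves
to use the fundamental theorem on an upper half-line.\<close>

lemma nn_integral_gumbel_kernel_atMost:
  fixes k :: real
  assumes k: "0 < k"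
  shows "(\<integral>\<^sup>+x. ennreal (exp (- x) * exp (- k * exp (- x))) * indicator {..z} x \<partial>lborel) =
    ennreal (exp (- k * exp (- z)) / k)"
proof -
  have "(\<integral>\<^sup>+x. ennreal (exp (- x) * exp (- k * exp (- x))) * indicator {..z} x \<partial>lborel) =
      (\<integral>\<^sup>+x. ennreal (exp x * exp (- k * exp x)) * indicator {- z..} x \<partial>lborel)"
    by (subst nn_integral_real_affine[where c="-1" and t=0])
      (auto intro!: nn_integral_cong split: split_indicator)
  also have "\<dots> = 0 - (- exp (- k * exp (- z)) / k)"
    using k by (intro nn_integral_FTC_atLeast[OF _ _ _ tendsto_gumbel_antiderivative])
      (auto intro!: derivative_eq_intros)
  finally show ?thesis by simp
qed

lemma nn_integral_gumbel_kernel: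
  fixes k :: real
  assumes k: "0 < k"
  shows "(\<integral>\<^sup>+x. ennreal (exp (- x) * exp (- k * exp (- x))) \<partial>lborel) = ennreal (1 / k)"
proof -
  let ?f = "\<lambda>x::real. exp (- x) * exp (- k * exp (- x))"
  have "((\<lambda>x. exp (- k * exp (- x)) / k) \<longlongrightarrow> exp (- k * 0) / k) at_top"
    using k by (intro tendsto_intros filterlim_compose[OF exp_at_bot filterlim_uminus_at_bot_at_top]) auto
  then have lim: "((\<lambda>x. exp (- k * exp (- x)) / k) \<longlongrightarrow> 1 / k) at_top" by simp
  have "(\<integral>\<^sup>+x. ennreal (?f x) \<partial>lborel) =
      (\<integral>\<^sup>+x. ennreal (?f x) * indicator {..0} x + ennreal (?f x) * indicator {0..} x \<partial>lborel)"
  proof (rule nn_integral_cong_AE, rule AE_mp[OF AE_lborel_singleton[of 0]], intro AE_I2 impI)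
    fix x :: real assume "x \<noteq> 0"
    then show "ennreal (?f x) = ennreal (?f x) * indicator {..0} x + ennreal (?f x) * indicator {0..} x"
      by (auto split: split_indicator)
  qed
  also have "\<dots> = (\<integral>\<^sup>+x. ennreal (?f x) * indicator {..0} x \<partial>lborel) +
      (\<integral>\<^sup>+x. ennreal (?f x) * indicator {0..} x \<partial>lborel)"
    by (rule nn_integral_add) auto
  also have "(\<integral>\<^sup>+x. ennreal (?f x) * indicator {0..} x \<partial>lborel) = 1 / k - exp (- k * exp (- 0)) / k"
    using k by (intro nn_integral_FTC_atLeast[OF _ _ _ lim]) (auto intro!: derivative_eq_intros)
  also have "(\<integral>\<^sup>+x. ennreal (?f x) * indicator {..0} x \<partial>lborel) = ennreal (exp (- k * exp (- 0)) / k)"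
    by (rule nn_integral_gumbel_kernel_atMost[OF k])
  also have "ennreal (exp (- k * exp (- 0)) / k) + ennreal (1 / k - exp (- k * exp (- 0)) / k) = ennreal (1 / k)"
    using k by (subst ennreal_plus[symmetric]) (auto simp: field_simps)
  finally show ?thesis .
qed

lemma sets_gumbel [simp, measurable_cong]: "sets gumbel = sets borel"
  and space_gumbel [simp]: "space gumbel = UNIV"
  by (auto simp: gumbel_def)

lemma nn_integral_gumbel:
  assumes [measurable]: "f \<in> borel_measurable borel"
  shows "(\<integral>\<^sup>+x. f x \<partial>gumbel) = (\<integral>\<^sup>+x. ennreal (exp (- x) * exp (- exp (- x))) * f x \<partial>lborel)"
  unfolding gumbel_def by (subst nn_integral_density) (auto simp: exp_add[symmetric])

lemma emeasure_gumbel_atMost: "emeasure gumbel {..z} = ennreal (exp (- exp (- z)))"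
  using nn_integral_gumbel[of "indicator {..z}"] nn_integral_gumbel_kernel_atMost[of 1 z] by simp

lemma prob_space_gumbel: "prob_space gumbel"
  using nn_integral_gumbel[of "\<lambda>_. 1"] nn_integral_gumbel_kernel[of 1]
  by (intro prob_spaceI) simp

interpretation gumbel: prob_space gumbel by (rule prob_space_gumbel)

definition logistic :: "real \<Rightarrow> real" where
  "logistic z = 1 / (1 + exp (- z))"

definition logistic_law :: "real \<Rightarrow> real measure" where
  "logistic_law a = distr (gumbel \<Otimes>\<^sub>M gumbel) borel (\<lambda>(x, y). a - x + y)"

lemma sets_logistic_law [simp, measurable_cong]: "sets (logistic_law a) = sets borel"
  and space_logistic_law [simp]: "space (logistic_law a) = UNIV"
  by (auto simp: logistic_law_def)

lemma prob_space_logistic_law: "prob_space (logistic_law a)"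
proof -
  interpret P: pair_prob_space gumbel gumbel ..
  show ?thesis unfolding logistic_law_def by (intro P.prob_space_distr) simp
qed

text \<open>Given the shock \<open>x\<close> of the lane, the cost is at most \<open>z\<close> if the shock of the outside option is at
most \<open>x + (z - a)\<close>. Multiplying the density at \<open>x\<close> by this Gumbel probability only changes the
factor in the exponent, from 1 to \<open>1 + exp (a - z)\<close>.\<close>

lemma measure_logistic_law_atMost: "measure (logistic_law a) {..z} = logistic (z - a)"
proof -
  have "emeasure (logistic_law a) {..z} =
      emeasure (gumbel \<Otimes>\<^sub>M gumbel) ((\<lambda>(x, y). a - x + y) -` {..z} \<inter> space (gumbel \<Otimes>\<^sub>M gumbel))"
    unfolding logistic_law_def by (subst emeasure_distr) simp_all
  also have "\<dots> = (\<integral>\<^sup>+x. emeasure gumbel (Pair x -` ((\<lambda>(x, y). a - x + y) -` {..z} \<inter> space (gumbel \<Otimes>\<^sub>M gumbel))) \<partial>gumbel)"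
    by (rule gumbel.emeasure_pair_measure_alt) measurable
  also have "\<dots> = (\<integral>\<^sup>+x. emeasure gumbel {..x + (z - a)} \<partial>gumbel)"
    by (intro nn_integral_cong arg_cong2[where f=emeasure] refl) (auto simp: space_pair_measure)
  also have "\<dots> = (\<integral>\<^sup>+x. ennreal (exp (- x) * exp (- (1 + exp (a - z)) * exp (- x))) \<partial>lborel)"
    unfolding emeasure_gumbel_atMost
    by (subst nn_integral_gumbel)
      (auto intro!: nn_integral_cong simp: ennreal_mult[symmetric] exp_add[symmetric] algebra_simps)
  also have "\<dots> = ennreal (1 / (1 + exp (a - z)))"
    by (intro nn_integral_gumbel_kernel) (simp add: add_pos_pos)
  finally show ?thesis by (simp add: measure_def logistic_def add_pos_pos less_imp_le)
qed

lemma DERIV_logistic: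
  "(logistic has_real_derivative logistic z * (1 - logistic z)) (at z)"
proof -
  have nz: "1 + exp (- z) \<noteq> 0" using exp_gt_zero[of "- z"] by linarith
  have "((\<lambda>z. 1 / (1 + exp (- z))) has_real_derivative
      (0 * (1 + exp (- z)) - 1 * (0 + exp (- z) * - 1)) / ((1 + exp (- z)) * (1 + exp (- z)))) (at z)"
    using nz by (intro derivative_intros DERIV_fun_exp) (auto intro!: derivative_eq_intros)
  also have "(0 * (1 + exp (- z)) - 1 * (0 + exp (- z) * - 1)) / ((1 + exp (- z)) * (1 + exp (- z))) =
      logistic z * (1 - logistic z)"
  proof -
    have "1 - logistic z = exp (- z) / (1 + exp (- z))"
      using nz by (simp add: logistic_def diff_divide_eq_iff)
    then show ?thesis by (simp add: logistic_def)
  qed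
  finally show ?thesis by (simp only: logistic_def[abs_def])
qed

lemma logistic_pos: "0 < logistic z"
  unfolding logistic_def by (intro divide_pos_pos add_pos_pos) auto

lemma logistic_less_1: "logistic z < 1"
proof -
  have "1 < 1 + exp (- z)" by simp
  then show ?thesis
    unfolding logistic_def using add_pos_pos[OF zero_less_one exp_gt_zero[of "- z"]]
    by (metis divide_less_eq_1_pos)
qed

lemma measure_logistic_law_singleton: "measure (logistic_law a) {z} = 0"
proof -
  interpret prob_space "logistic_law a" by (rule prob_space_logistic_law)
  interpret finite_borel_measure "logistic_law a" by standard simp
  have "cdf (logistic_law a) = (\<lambda>z. logistic (z - a))"
    by (simp add: fun_eq_iff cdf_def measure_logistic_law_atMost)
  moreover have "isCont (\<lambda>z. logistic (z - a)) z"
    by (rule isCont_o2[where f="\<lambda>z. z - a" and g=logistic])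
      (simp_all add: DERIV_isCont[OF DERIV_logistic])
  ultimately show ?thesis using isCont_cdf by simp
qed

lemma AE_logistic_law_neq: "AE c in logistic_law a. c \<noteq> z"
proof (rule AE_I)
  interpret prob_space "logistic_law a" by (rule prob_space_logistic_law)
  show "emeasure (logistic_law a) {z} = 0"
    by (simp add: emeasure_eq_measure measure_logistic_law_singleton)
qed auto

lemma measure_logistic_law_lessThan: "measure (logistic_law a) {..<z} = logistic (z - a)"
proof -
  interpret prob_space "logistic_law a" by (rule prob_space_logistic_law)
  have "measure (logistic_law a) ({..<z} \<union> {z}) =
      measure (logistic_law a) {..<z} + measure (logistic_law a) {z}"
    by (intro finite_measure_Union) auto
  then show ?thesis
    using measure_logistic_law_singleton[of a z] measure_logistic_law_atMost[of a z]
    unfolding ivl_disj_un(2) by simp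
qed

lemma sets_shock_space [measurable_cong]: "sets shock_space = sets (Pi\<^sub>M UNIV (\<lambda>_. gumbel))"
  by (simp add: shock_space_def)

lemma prob_space_shock_space: "prob_space shock_space"
  unfolding shock_space_def by (intro prob_space_PiM prob_space_gumbel)

lemma indep_vars_iid_components:
  fixes N :: "'b measure"
  assumes "prob_space N"
  defines "P \<equiv> PiM (UNIV :: 'k set) (\<lambda>_. N)"
  shows "prob_space.indep_vars P (\<lambda>_. N) (\<lambda>k e. e k) UNIV"
proof -
  interpret prob_space P unfolding P_def using assms by (intro prob_space_PiM)
  have "distr P N (\<lambda>e. e k) = N" for k
    unfolding P_def using assms by (intro distr_PiM_component) simp_all
  then have "distr P (PiM UNIV (\<lambda>_. N)) (\<lambda>e. \<lambda>k\<in>UNIV. e k) = (\<Pi>\<^sub>M k\<in>UNIV. distr P N (\<lambda>e. e k))"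
    by (simp add: P_def distr_id restrict_UNIV)
  then show ?thesis by (subst indep_vars_iff_distr_eq_PiM) (simp_all add: P_def)
qed

lemma indep_shocks: "prob_space.indep_vars shock_space (\<lambda>_. gumbel) (\<lambda>k e. e k) UNIV"
  unfolding shock_space_def by (rule indep_vars_iid_components) (rule prob_space_gumbel)

lemma distr_bid:
  assumes "j \<noteq> 0"
  shows "distr shock_space borel (\<lambda>e. a - e (i, s, j) + e (i, s, 0)) = logistic_law a"
proof -
  interpret prob_space shock_space by (rule prob_space_shock_space)
  let ?k = "(i, s, j)" and ?l = "(i, s, 0)"
  have marg: "distr shock_space gumbel (\<lambda>e. e k) = gumbel" for k
    unfolding shock_space_def by (intro distr_PiM_component prob_space_gumbel) simp
  have "indep_var (PiM {?k} (\<lambda>_. gumbel)) (\<lambda>e. restrict (\<lambda>k. e k) {?k})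
      (PiM {?l} (\<lambda>_. gumbel)) (\<lambda>e. restrict (\<lambda>k. e k) {?l})"
    using assms by (intro indep_var_restrict[OF indep_shocks]) auto
  from indep_var_compose[OF this, of "\<lambda>f. f ?k" gumbel "\<lambda>f. f ?l" gumbel]
  have "indep_var gumbel (\<lambda>e. e ?k) gumbel (\<lambda>e. e ?l)"
    by (simp add: comp_def)
  then have "gumbel \<Otimes>\<^sub>M gumbel = distr shock_space (gumbel \<Otimes>\<^sub>M gumbel) (\<lambda>e. (e ?k, e ?l))"
    by (simp add: indep_var_distribution_eq marg)
  then have "logistic_law a = distr (distr shock_space (gumbel \<Otimes>\<^sub>M gumbel) (\<lambda>e. (e ?k, e ?l))) borel (\<lambda>(x, y). a - x + y)"
    unfolding logistic_law_def by simp
  also have "\<dots> = distr shock_space borel (\<lambda>e. a - e ?k + e ?l)"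
    by (subst distr_distr) (simp_all add: comp_def)
  finally show ?thesis by simp
qed

text \<open>The costs of different carriers depend on disjoint sets of shocks.\<close>

lemma distr_bids:
  assumes "j \<noteq> 0"
  shows "distr shock_space (\<Pi>\<^sub>M s\<in>UNIV. borel) (\<lambda>e s. a - e (i, s, j) + e (i, s, 0)) =
    (\<Pi>\<^sub>M s\<in>UNIV. logistic_law a)"
proof -
  interpret prob_space shock_space by (rule prob_space_shock_space)
  let ?K = "\<lambda>s. {(i, s, j), (i, s, 0)}"
  have "indep_vars (\<lambda>s. PiM (?K s) (\<lambda>_. gumbel)) (\<lambda>s e. restrict (\<lambda>k. e k) (?K s)) UNIV"
    by (intro indep_vars_restrict[OF indep_shocks]) (auto simp: disjoint_family_on_def)
  from indep_vars_compose2[OF this, of "\<lambda>s f. a - f (i, s, j) + f (i, s, 0)" "\<lambda>_. borel"]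
  have "indep_vars (\<lambda>_. borel) (\<lambda>s e. a - e (i, s, j) + e (i, s, 0)) UNIV" by simp
  then show ?thesis
    by (subst (asm) indep_vars_iff_distr_eq_PiM) (simp_all add: distr_bid[OF assms] restrict_UNIV)
qed

lemma logistic_0: "logistic 0 = 1 / 2"
  by (simp add: logistic_def)

lemma logistic_mono: "z \<le> w \<Longrightarrow> logistic z \<le> logistic w"
  by (rule DERIV_nonneg_imp_nondecreasing, assumption)
    (meson DERIV_logistic diff_ge_0_iff_ge logistic_less_1 logistic_pos mult_nonneg_nonneg less_imp_le)

lemma logistic_le_half_plus:
  assumes "0 \<le> z"
  shows "logistic z \<le> 1 / 2 + z / 4"
proof -
  have "0 / 4 - logistic 0 \<le> z / 4 - logistic z"
  proof (rule DERIV_nonneg_imp_nondecreasing[OF assms], intro exI conjI)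
    fix x :: real
    show "((\<lambda>z. z / 4 - logistic z) has_real_derivative 1 / 4 - logistic x * (1 - logistic x)) (at x)"
      by (intro derivative_intros DERIV_logistic DERIV_cdivide DERIV_ident)
    have "0 \<le> (logistic x - 1 / 2)\<^sup>2" by simp
    then show "0 \<le> 1 / 4 - logistic x * (1 - logistic x)"
      by (simp add: power2_eq_square algebra_simps)
  qed
  then show ?thesis by (simp add: logistic_0)
qed

text \<open>On the nonnegative half-line the density decreases, so up to \<open>w\<close> it is at least its value at \<open>w\<close>.\<close>

lemma logistic_ge_linear:
  assumes z: "0 \<le> z" "z \<le> w"
  shows "1 / 2 + logistic w * (1 - logistic w) * z \<le> logistic z"
proof -
  let ?l = "logistic w * (1 - logistic w)"
  have "logistic 0 - ?l * 0 \<le> logistic z - ?l * z"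
  proof (rule DERIV_nonneg_imp_nondecreasing[OF z(1)], intro exI conjI)
    fix x :: real assume x: "0 \<le> x" "x \<le> z"
    show "((\<lambda>z. logistic z - ?l * z) has_real_derivative logistic x * (1 - logistic x) - ?l) (at x)"
      by (auto intro!: derivative_eq_intros DERIV_logistic)
    have "1 / 2 \<le> logistic x" "logistic x \<le> logistic w"
      using logistic_mono[of 0 x] logistic_mono[of x w] x z by (auto simp: logistic_0)
    then have "0 \<le> (logistic w - logistic x) * (logistic w + logistic x - 1)"
      by (intro mult_nonneg_nonneg) auto
    then show "0 \<le> logistic x * (1 - logistic x) - ?l" by (simp add: algebra_simps)
  qed
  then show ?thesis by (simp add: logistic_0)
qed

text \<open>For \<open>z = \<tau> - p\<close> this bounds the gain from facing a carrier with the threshold \<open>\<tau>\<close> instead of the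
posted price \<open>p\<close>. The higher threshold costs \<open>z\<close> more for the half of the carriers below \<open>p\<close>. It
attracts further carriers at density at least \<open>e / (1 + e)\<^sup>2\<close>, each of whom is worth at least \<open>1 + e\<close>.
Their product \<open>e / (1 + e)\<close> is at least \<open>2 / 3\<close>, and \<open>2 / 3 - 1 / 2 = 1 / 6\<close>.\<close>

lemma posted_threshold_gain:
  assumes "0 \<le> z" "z \<le> 1"
  shows "z / 6 \<le> (2 + exp 1 - z) * logistic z - (2 + exp 1) / 2"
proof -
  let ?l = "logistic 1 * (1 - logistic 1)"
  have e: "2 \<le> exp (1::real)" using exp_ge_add_one_self[of 1] by simp
  have L1: "logistic 1 = exp 1 / (1 + exp 1)"
    using e by (simp add: logistic_def exp_minus field_simps)
  have "1 - logistic 1 = 1 / (1 + exp 1)"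
    using e unfolding L1 by (simp add: field_simps)
  then have "(1 + exp 1) * (1 - logistic 1) = 1" using e by (simp add: field_simps)
  then have "(1 + exp 1) * ?l = logistic 1" by (metis mult.left_commute mult.right_neutral)
  moreover have "2 / 3 \<le> logistic 1" using e by (simp add: L1 field_simps)
  ultimately have l: "2 / 3 \<le> (1 + exp 1) * ?l" by (simp only:)
  have "z / 6 \<le> z * ((1 + exp 1) * ?l - 1 / 2)"
  proof -
    have "1 / 6 \<le> (1 + exp 1) * ?l - 1 / 2" using l by linarith
    from mult_left_mono[OF this assms(1)] show ?thesis by simp
  qed
  also have "\<dots> = (1 + exp 1) * (?l * z) - z / 2" by (simp add: algebra_simps)
  also have "(1 + exp 1) * (?l * z) \<le> (2 + exp 1 - z) * (logistic z - 1 / 2)"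
    using assms logistic_ge_linear[of z 1] e
    by (intro mult_mono mult_nonneg_nonneg) (auto simp: logistic_pos less_imp_le logistic_less_1)
  also have "(2 + exp 1 - z) * (logistic z - 1 / 2) - z / 2 = (2 + exp 1 - z) * logistic z - (2 + exp 1) / 2"
    by (simp add: field_simps)
  finally show ?thesis by simp
qed

section \<open>Expected gain for given numbers of carriers and loads\<close>

definition bid_space :: "real \<Rightarrow> (nat \<Rightarrow> real) measure" where
  "bid_space a = (\<Pi>\<^sub>M s\<in>UNIV. logistic_law a)"

lemma prob_space_bid_space: "prob_space (bid_space a)"
  unfolding bid_space_def by (intro prob_space_PiM prob_space_logistic_law)

lemma sets_bid_space: "sets (bid_space a) = sets (\<Pi>\<^sub>M s\<in>UNIV. borel)"
  unfolding bid_space_def by (intro sets_PiM_cong) simp_all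

lemma space_bid_space [simp]: "space (bid_space a) = UNIV"
  by (simp add: bid_space_def space_PiM)

lemma measurable_bid [measurable]: "(\<lambda>c. c s) \<in> borel_measurable (bid_space a)"
  unfolding bid_space_def by measurable

text \<open>The bid of carrier \<open>s\<close> is independent of all other bids, so it can be averaged out first.\<close>

lemma integral_bid_space_resample:
  fixes f :: "(nat \<Rightarrow> real) \<Rightarrow> real"
  assumes f: "integrable (bid_space a) f"
  shows "integrable (\<Pi>\<^sub>M t\<in>UNIV - {s}. logistic_law a) (\<lambda>X. \<integral>z. f (X(s := z)) \<partial>logistic_law a)"
    "(\<integral>c. f c \<partial>bid_space a) =
      (\<integral>X. \<integral>z. f (X(s := z)) \<partial>logistic_law a \<partial>(\<Pi>\<^sub>M t\<in>UNIV - {s}. logistic_law a))"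
proof -
  let ?R = "\<Pi>\<^sub>M t\<in>UNIV - {s}. logistic_law a"
  interpret L: prob_space "logistic_law a" by (rule prob_space_logistic_law)
  interpret R: prob_space ?R by (intro prob_space_PiM prob_space_logistic_law)
  interpret P: pair_sigma_finite "logistic_law a" ?R ..
  have ins: "insert s (UNIV - {s}) = UNIV" by auto
  have upd [measurable]: "(\<lambda>(z, X). X(s := z)) \<in> logistic_law a \<Otimes>\<^sub>M ?R \<rightarrow>\<^sub>M bid_space a"
    unfolding bid_space_def
    using measurable_fun_upd[of UNIV "UNIV - {s}" s snd "logistic_law a \<Otimes>\<^sub>M ?R" "\<lambda>_. logistic_law a" fst]
    by (auto simp: case_prod_beta)
  have D: "distr (logistic_law a \<Otimes>\<^sub>M ?R) (bid_space a) (\<lambda>(z, X). X(s := z)) = bid_space a"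
    using distr_pair_PiM_eq_PiM[of "UNIV - {s}" "\<lambda>_. logistic_law a" s] prob_space_logistic_law
    unfolding bid_space_def ins by simp
  have [measurable]: "f \<in> borel_measurable (bid_space a)" using f by auto
  have int: "integrable (logistic_law a \<Otimes>\<^sub>M ?R) (\<lambda>(z, X). f (X(s := z)))"
    using f integrable_distr_eq[OF upd, of f] by (subst (asm) D[symmetric]) (simp add: case_prod_beta')
  show "integrable ?R (\<lambda>X. \<integral>z. f (X(s := z)) \<partial>logistic_law a)"
    by (rule P.integrable_snd[OF int])
  have "(\<integral>c. f c \<partial>bid_space a) = (\<integral>y. (\<lambda>(z, X). f (X(s := z))) y \<partial>(logistic_law a \<Otimes>\<^sub>M ?R))"
    by (subst D[symmetric], subst integral_distr[OF upd]) (simp_all add: case_prod_beta')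
  also have "\<dots> = (\<integral>X. \<integral>z. f (X(s := z)) \<partial>logistic_law a \<partial>?R)"
    using P.integral_snd[OF int] by simp
  finally show "(\<integral>c. f c \<partial>bid_space a) = (\<integral>X. \<integral>z. f (X(s := z)) \<partial>logistic_law a \<partial>?R)" .
qed

lemma integral_bid_space_mono_resample:
  fixes f g :: "(nat \<Rightarrow> real) \<Rightarrow> real"
  assumes f: "integrable (bid_space a) f" and g: "integrable (bid_space a) g"
    and le: "\<And>X. (\<integral>z. f (X(s := z)) \<partial>logistic_law a) \<le> (\<integral>z. g (X(s := z)) \<partial>logistic_law a)"
  shows "(\<integral>c. f c \<partial>bid_space a) \<le> (\<integral>c. g c \<partial>bid_space a)"
  unfolding integral_bid_space_resample(2)[OF f, of s] integral_bid_space_resample(2)[OF g, of s]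
  by (intro integral_mono integral_bid_space_resample(1) f g le)

lemma measurable_cutoff_bids [measurable]:
  "(\<lambda>c. cutoff {..<n} d x c s) \<in> borel_measurable (bid_space a)"
  by (intro measurable_cutoff) auto

text \<open>Given the other bids, a carrier's cutoff is a constant, and the logistic law has no atoms.\<close>

lemma AE_no_ties:
  "AE c in bid_space a. \<forall>s<n. c s \<noteq> p \<and> c s \<noteq> cutoff {..<n} d x c s"
proof -
  interpret prob_space "bid_space a" by (rule prob_space_bid_space)
  interpret L: prob_space "logistic_law a" by (rule prob_space_logistic_law)
  have 1: "AE c in bid_space a. c s \<noteq> p" for s
    unfolding bid_space_def
    by (rule AE_PiM_component[OF prob_space_logistic_law _ AE_logistic_law_neq]) simp
  have 2: "AE c in bid_space a. c s \<noteq> cutoff {..<n} d x c s" for s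
  proof -
    let ?f = "\<lambda>c. of_bool (c s = cutoff {..<n} d x c s) :: real"
    have [measurable]: "Measurable.pred (bid_space a) (\<lambda>c. c s = cutoff {..<n} d x c s)"
    proof -
      have "Measurable.pred (bid_space a) (\<lambda>c. c s - cutoff {..<n} d x c s = 0)" by measurable
      then show ?thesis by simp
    qed
    have int: "integrable (bid_space a) ?f"
      by (rule integrable_const_bound[where B=1]) (simp_all, measurable)
    have "(\<integral>c. ?f c \<partial>bid_space a) \<le> (\<integral>c. 0 \<partial>bid_space a)"
    proof (rule integral_bid_space_mono_resample[where s=s, OF int])
      fix X :: "nat \<Rightarrow> real"
      have *: "cutoff {..<n} d x (X(s := z)) s = cutoff {..<n} d x X s" for z
        by (rule cutoff_cong) auto
      have "(\<lambda>z. ?f (X(s := z))) = indicator {cutoff {..<n} d x X s}"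
        unfolding * fun_upd_same by (auto simp: indicator_def)
      then have "(\<integral>z. ?f (X(s := z)) \<partial>logistic_law a) = 0"
        by (simp add: measure_logistic_law_singleton)
      then show "(\<integral>z. ?f (X(s := z)) \<partial>logistic_law a) \<le> (\<integral>z. 0 \<partial>logistic_law a)" by simp
    qed simp
    moreover have "0 \<le> (\<integral>c. ?f c \<partial>bid_space a)" by (rule Bochner_Integration.integral_nonneg) simp
    ultimately have "(\<integral>c. ?f c \<partial>bid_space a) = 0" by simp
    then show ?thesis by (subst (asm) integral_nonneg_eq_0_iff_AE[OF int]) auto
  qed
  show ?thesis using 1 2 by (auto simp: AE_all_countable)
qed

lemma measurable_cutoff_gain [measurable]:
  "(\<lambda>c. cutoff_gain b p x n d c s) \<in> borel_measurable (bid_space a)"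
  unfolding cutoff_gain_def by measurable

lemma cutoff_gain_bounded:
  assumes "p \<le> x" "x \<le> b"
  shows "\<bar>cutoff_gain b p x n d c s\<bar> \<le> b - p"
proof (cases "card {t\<in>{..<n} - {s}. c t < p} < d")
  case True
  then have "p \<le> cutoff {..<n} d x c s" "cutoff {..<n} d x c s \<le> x"
    using assms by (auto intro: cutoff_ge cutoff_le_reserve)
  then show ?thesis using assms True by (auto simp: cutoff_gain_def of_bool_def)
qed (use assms in \<open>auto simp: cutoff_gain_def\<close>)

lemma integrable_cutoff_gain:
  assumes "p \<le> x" "x \<le> b"
  shows "integrable (bid_space a) (\<lambda>c. cutoff_gain b p x n d c s)"
proof -
  interpret prob_space "bid_space a" by (rule prob_space_bid_space)
  show ?thesis
    using cutoff_gain_bounded[OF assms] by (intro integrable_const_bound[where B="b - p"]) auto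
qed

text \<open>Averaging over the own bid of \<open>s\<close> first turns his gain into the quantity bounded by
\<open>posted_threshold_gain\<close>, at his cutoff. The cutoff is at least \<open>a + \<delta>\<close> if fewer than \<open>d\<close> bids are
below that value.\<close>

lemma expected_cutoff_gain:
  assumes b: "b = a + 2 + exp 1" and \<delta>: "0 \<le> \<delta>" "\<delta> \<le> 1"
  shows "\<delta> / 6 * measure (bid_space a) {c. card {t\<in>{..<n}. c t < a + \<delta>} < d}
    \<le> (\<integral>c. cutoff_gain b a (a + 1) n d c s \<partial>bid_space a)"
proof -
  interpret prob_space "bid_space a" by (rule prob_space_bid_space)
  interpret L: prob_space "logistic_law a" by (rule prob_space_logistic_law)
  let ?few = "\<lambda>\<delta> c. card {t\<in>{..<n} - {s}. c t < a + \<delta>} < d"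
  let ?g = "\<lambda>c. cutoff_gain b a (a + 1) n d c s"
  have [measurable]: "Measurable.pred (bid_space a) (?few z)" for z by measurable
  have int: "integrable (bid_space a) (\<lambda>c. \<delta> / 6 * of_bool (?few \<delta> c))"
    using \<delta> by (intro integrable_const_bound[where B="\<delta> / 6"]) auto
  have "\<delta> / 6 * measure (bid_space a) {c. card {t\<in>{..<n}. c t < a + \<delta>} < d}
      \<le> \<delta> / 6 * measure (bid_space a) {c. ?few \<delta> c}"
  proof (intro mult_left_mono finite_measure_mono subsetI)
    fix c assume "c \<in> {c. card {t\<in>{..<n}. c t < a + \<delta>} < d}"
    moreover have "card {t\<in>{..<n} - {s}. c t < a + \<delta>} \<le> card {t\<in>{..<n}. c t < a + \<delta>}"
      by (intro card_mono) auto
    ultimately show "c \<in> {c. ?few \<delta> c}" by simp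
  next
    have "{c \<in> space (bid_space a). ?few \<delta> c} \<in> events" by measurable
    then show "{c. ?few \<delta> c} \<in> events" by simp
  qed (use \<delta> in auto)
  also have "\<dots> = (\<integral>c. \<delta> / 6 * of_bool (?few \<delta> c) \<partial>bid_space a)"
  proof -
    have "(\<lambda>c. of_bool (?few \<delta> c) :: real) = indicator {c. ?few \<delta> c}"
      by (auto simp: indicator_def)
    then show ?thesis by simp
  qed
  also have "\<dots> \<le> (\<integral>c. ?g c \<partial>bid_space a)"
  proof (rule integral_bid_space_mono_resample[where s=s, OF int])
    show "integrable (bid_space a) ?g"
      using b by (intro integrable_cutoff_gain) (auto simp: add_pos_pos less_imp_le)
    fix X :: "nat \<Rightarrow> real"
    define \<tau> where "\<tau> = cutoff {..<n} d (a + 1) X s"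
    have cut: "cutoff {..<n} d (a + 1) (X(s := z)) s = \<tau>" for z
      unfolding \<tau>_def by (rule cutoff_cong) auto
    have others: "{t\<in>{..<n} - {s}. (X(s := z)) t < y} = {t\<in>{..<n} - {s}. X t < y}" for y z
      by auto
    have lhs: "(\<integral>z. \<delta> / 6 * of_bool (?few \<delta> (X(s := z))) \<partial>logistic_law a) = \<delta> / 6 * of_bool (?few \<delta> X)"
      unfolding others using L.prob_space by simp
    have rhs: "(\<integral>z. ?g (X(s := z)) \<partial>logistic_law a) =
        of_bool (?few 0 X) * ((b - \<tau>) * logistic (\<tau> - a) - (b - a) / 2)"
    proof -
      have ind: "(of_bool (z < y) :: real) = indicator {..<y} z" for y z :: real
        by (auto simp: indicator_def)
      have "(\<integral>z. (b - \<tau>) * of_bool (z < \<tau>) - (b - a) * of_bool (z < a) \<partial>logistic_law a) =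
          (b - \<tau>) * logistic (\<tau> - a) - (b - a) * logistic (a - a)"
        unfolding ind
        by (subst Bochner_Integration.integral_diff)
          (auto simp: measure_logistic_law_lessThan
            intro!: integrable_mult_right L.integrable_const_bound[where B=1] borel_measurable_indicator)
      then show ?thesis
        unfolding cutoff_gain_def cut others fun_upd_same by (auto simp: logistic_0)
    qed
    show "(\<integral>z. \<delta> / 6 * of_bool (?few \<delta> (X(s := z))) \<partial>logistic_law a)
        \<le> (\<integral>z. ?g (X(s := z)) \<partial>logistic_law a)"
    proof (cases "?few 0 X")
      case False
      have "card {t\<in>{..<n} - {s}. X t < a + 0} \<le> card {t\<in>{..<n} - {s}. X t < a + \<delta>}"
        using \<delta> by (intro card_mono) auto
      with False have "\<not> ?few \<delta> X" by simp
      with False show ?thesis unfolding lhs rhs by simp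
    next
      case True
      have up: "\<tau> \<le> a + 1" unfolding \<tau>_def by (rule cutoff_le_reserve) simp
      have lo: "a \<le> \<tau>" unfolding \<tau>_def using True by (intro cutoff_ge) auto
      have "\<delta> * of_bool (?few \<delta> X) \<le> \<tau> - a"
      proof (cases "?few \<delta> X")
        case True
        then have "a + \<delta> \<le> \<tau>" unfolding \<tau>_def using \<delta> by (intro cutoff_ge) auto
        with True show ?thesis by simp
      qed (use lo in simp)
      moreover have "(\<tau> - a) / 6 \<le> (2 + exp 1 - (\<tau> - a)) * logistic (\<tau> - a) - (2 + exp 1) / 2"
        using up lo by (intro posted_threshold_gain) auto
      ultimately have "\<delta> / 6 * of_bool (?few \<delta> X)
          \<le> (2 + exp 1 - (\<tau> - a)) * logistic (\<tau> - a) - (2 + exp 1) / 2"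
        by (simp add: mult.commute[of \<delta>])
      also have "\<dots> = (b - \<tau>) * logistic (\<tau> - a) - (b - a) / 2"
        by (simp add: b algebra_simps)
      finally show ?thesis unfolding lhs rhs using True by simp
    qed
  qed
  finally show ?thesis .
qed

text \<open>For \<open>\<delta> = 0\<close> this says that the hybrid mechanism does not lose on average, whatever the numbers of
carriers and loads; a positive \<open>\<delta>\<close> serves when loads are abundant.\<close>

lemma expected_hybrid_gain:
  assumes b: "b = a + 2 + exp 1" and a: "0 \<le> a" and \<delta>: "0 \<le> \<delta>" "\<delta> \<le> 1"
  shows "real n * \<delta> / 6 * measure (bid_space a) {c. card {t\<in>{..<n}. c t < a + \<delta>} < d}
    \<le> (\<integral>c. surplus b (hyb_outcome a (a + 1) n d c) - surplus b (sp_outcome a n d c) \<partial>bid_space a)"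
proof -
  have b1: "a + 1 \<le> b" using b exp_gt_zero[of "1::real"] by simp
  note [measurable] = measurable_hyb_outcome[OF measurable_bid] measurable_sp_outcome[OF measurable_bid]
  have "real n * \<delta> / 6 * measure (bid_space a) {c. card {t\<in>{..<n}. c t < a + \<delta>} < d} =
      (\<Sum>s<n. \<delta> / 6 * measure (bid_space a) {c. card {t\<in>{..<n}. c t < a + \<delta>} < d})"
    by simp
  also have "\<dots> \<le> (\<Sum>s<n. \<integral>c. cutoff_gain b a (a + 1) n d c s \<partial>bid_space a)"
    by (intro sum_mono expected_cutoff_gain assms)
  also have "\<dots> = (\<integral>c. (\<Sum>s<n. cutoff_gain b a (a + 1) n d c s) \<partial>bid_space a)"
    using b1 by (intro Bochner_Integration.integral_sum[symmetric] integrable_cutoff_gain) auto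
  also have "\<dots> = (\<integral>c. surplus b (hyb_outcome a (a + 1) n d c) - surplus b (sp_outcome a n d c) \<partial>bid_space a)"
  proof (rule integral_cong_AE)
    show "AE c in bid_space a. (\<Sum>s<n. cutoff_gain b a (a + 1) n d c s) =
        surplus b (hyb_outcome a (a + 1) n d c) - surplus b (sp_outcome a n d c)"
      using AE_no_ties[where a=a and p=a and n=n and d=d and x="a + 1"]
      by eventually_elim (rule hybrid_gain_eq_sum_cutoff_gain[symmetric], auto)
  qed (unfold surplus_def, measurable)
  finally show ?thesis .
qed

lemma prob_many_low_bids:
  assumes n: "0 < n" and \<epsilon>: "0 \<le> \<epsilon>"
  shows "measure (bid_space a) {c. real n * logistic (z - a) + \<epsilon> \<le> real (card {t\<in>{..<n}. c t < z})}
    \<le> exp (- 2 * \<epsilon>\<^sup>2 / real n)"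
proof -
  interpret prob_space "bid_space a" by (rule prob_space_bid_space)
  let ?X = "\<lambda>t c. of_bool (c t < z) :: real"
  define \<mu> where "\<mu> = (\<Sum>t<n. expectation (?X t))"
  have "indep_vars (\<lambda>_. logistic_law a) (\<lambda>t c. c t) UNIV"
    unfolding bid_space_def by (rule indep_vars_iid_components) (rule prob_space_logistic_law)
  from indep_vars_compose2[OF this, of "\<lambda>_ y. of_bool (y < z) :: real" "\<lambda>_. borel"]
  have "indep_vars (\<lambda>_. borel) ?X UNIV" by simp
  then have "indep_vars (\<lambda>_. borel) ?X {..<n}" by (rule indep_vars_subset) simp
  then interpret Hoeffding_ineq "bid_space a" "{..<n}" ?X "\<lambda>_. 0" "\<lambda>_. 1" \<mu>
    by unfold_locales (auto simp: \<mu>_def)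
  have "expectation (?X t) = logistic (z - a)" for t
  proof -
    have "expectation (?X t) = (\<integral>y. of_bool (y < z) \<partial>distr (bid_space a) (logistic_law a) (\<lambda>c. c t))"
      by (subst integral_distr) (auto simp: bid_space_def)
    also have "distr (bid_space a) (logistic_law a) (\<lambda>c. c t) = logistic_law a"
      unfolding bid_space_def by (intro distr_PiM_component prob_space_logistic_law) simp
    also have "(\<integral>y. of_bool (y < z) \<partial>logistic_law a) = (\<integral>y. indicator {..<z} y \<partial>logistic_law a)"
      by (intro Bochner_Integration.integral_cong) (auto simp: indicator_def)
    also have "\<dots> = logistic (z - a)"
      by (simp add: measure_logistic_law_lessThan)
    finally show ?thesis .
  qed
  then have \<mu>: "\<mu> = real n * logistic (z - a)" by (simp add: \<mu>_def)
  show ?thesis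
    using Hoeffding_ineq_ge[OF \<epsilon>] n unfolding \<mu> real_card_filter[OF finite_lessThan] by simp
qed

section \<open>Deviations of the Poisson distribution\<close>

text \<open>Stein's identity for the Poisson distribution, from which the first two moments follow.\<close>

lemma nn_integral_poisson_pmf_mult_id:
  assumes a: "0 < a"
  shows "(\<integral>\<^sup>+k. ennreal (real k * f k) \<partial>poisson_pmf a) = (\<integral>\<^sup>+k. ennreal (a * f (Suc k)) \<partial>poisson_pmf a)"
proof -
  let ?w = "\<lambda>k. ennreal (pmf (poisson_pmf a) k)"
  \<comment> \<open>The weights satisfy \<open>(k + 1) * w (k + 1) = a * w k\<close>.\<close>
  have step: "?w (Suc k) * ennreal (real (Suc k) * f (Suc k)) = ?w k * ennreal (a * f (Suc k))" for k
  proof -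
    have "pmf (poisson_pmf a) (Suc k) * (real (Suc k) * f (Suc k)) = pmf (poisson_pmf a) k * (a * f (Suc k))"
      using a by (simp add: field_simps del: of_nat_Suc)
    then show ?thesis by (metis ennreal_mult' pmf_nonneg)
  qed
  have "(\<lambda>k. ?w (Suc k) * ennreal (real (Suc k) * f (Suc k))) sums
      (\<Sum>k. ?w k * ennreal (a * f (Suc k)))"
    unfolding step by (rule summable_sums) (rule summableI)
  from sums_Suc[OF this] have
    "(\<lambda>k. ?w k * ennreal (real k * f k)) sums (\<Sum>k. ?w k * ennreal (a * f (Suc k)))" by simp
  then show ?thesis
    by (simp add: nn_integral_measure_pmf nn_integral_count_space_nat sums_iff)
qed

lemma poisson_pmf_moments:
  assumes a: "0 < a"
  shows "integrable (poisson_pmf a) real" "(\<integral>k. real k \<partial>poisson_pmf a) = a"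
    "integrable (poisson_pmf a) (\<lambda>k. (real k)\<^sup>2)" "(\<integral>k. (real k)\<^sup>2 \<partial>poisson_pmf a) = a\<^sup>2 + a"
proof -
  have 1: "(\<integral>\<^sup>+k. ennreal (real k) \<partial>poisson_pmf a) = ennreal a"
    using nn_integral_poisson_pmf_mult_id[OF a, of "\<lambda>_. 1"] by simp
  have "(\<integral>\<^sup>+k. ennreal (a * real (Suc k)) \<partial>poisson_pmf a) =
      (\<integral>\<^sup>+k. ennreal a * ennreal (real k) + ennreal a \<partial>poisson_pmf a)"
    using a by (intro nn_integral_cong)
      (simp add: distrib_left add.commute flip: ennreal_mult ennreal_plus)
  also have "\<dots> = ennreal a * (\<integral>\<^sup>+k. ennreal (real k) \<partial>poisson_pmf a) + ennreal a"
    by (simp add: nn_integral_add nn_integral_cmult)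
  also have "\<dots> = ennreal (a\<^sup>2 + a)"
    using a by (simp add: 1 power2_eq_square flip: ennreal_mult ennreal_plus)
  finally have 2: "(\<integral>\<^sup>+k. ennreal ((real k)\<^sup>2) \<partial>poisson_pmf a) = ennreal (a\<^sup>2 + a)"
    using nn_integral_poisson_pmf_mult_id[OF a, of real] by (simp add: power2_eq_square)
  show "integrable (poisson_pmf a) real" using 1 a by (intro integrableI_nn_integral_finite[where x=a]) auto
  show "(\<integral>k. real k \<partial>poisson_pmf a) = a" using 1 a by (subst integral_eq_nn_integral) auto
  show "integrable (poisson_pmf a) (\<lambda>k. (real k)\<^sup>2)"
    using 2 a by (intro integrableI_nn_integral_finite[where x="a\<^sup>2 + a"]) auto
  show "(\<integral>k. (real k)\<^sup>2 \<partial>poisson_pmf a) = a\<^sup>2 + a"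
    using 2 a by (subst integral_eq_nn_integral) (auto simp del: ennreal_plus)
qed

lemma poisson_pmf_concentration:
  assumes a: "0 < a" and t: "0 < t"
  shows "measure (poisson_pmf a) {k. t \<le> \<bar>real k - a\<bar>} \<le> a / t\<^sup>2"
proof -
  note m = poisson_pmf_moments[OF a]
  have "measure_pmf.variance (poisson_pmf a) real = a"
    using m by (subst measure_pmf.variance_eq) auto
  then show ?thesis
    using measure_pmf.Chebyshev_inequality[of real "poisson_pmf a" t] m t by simp
qed

lemma poisson_pmf_shift:
  assumes a: "0 < a"
  shows "i \<le> j \<Longrightarrow> pmf (poisson_pmf a) k * a ^ i \<le> pmf (poisson_pmf a) (k + i) * real (k + j) ^ i"
proof (induction i)
  case (Suc i)
  have "pmf (poisson_pmf a) k * a ^ Suc i \<le> (a * pmf (poisson_pmf a) (k + i)) * real (k + j) ^ i"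
    using mult_left_mono[OF Suc.IH, of a] Suc.prems a by (simp add: ac_simps)
  also have "a * pmf (poisson_pmf a) (k + i) = pmf (poisson_pmf a) (k + Suc i) * real (k + Suc i)"
    using a by (simp add: field_simps del: of_nat_Suc of_nat_add)
  also have "\<dots> * real (k + j) ^ i \<le> (pmf (poisson_pmf a) (k + Suc i) * real (k + j)) * real (k + j) ^ i"
    using Suc.prems by (intro mult_right_mono mult_left_mono) auto
  finally show ?case by (simp add: ac_simps)
qed simp

text \<open>Chebyshev's inequality puts probability \<open>3 / 4\<close> within \<open>2 * sqrt a\<close> of the mean. Shifting this window
upwards by about \<open>8 * sqrt a\<close> moves it beyond \<open>a + 6 * sqrt a\<close>, and each of the at most \<open>9 * sqrt a\<close>
steps of the shift reduces the point masses by a factor no worse than \<open>1 + 11 / sqrt a\<close>.\<close>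

lemma poisson_pmf_upper_deviation:
  assumes a: "1 \<le> a"
  shows "exp (- 99) * (3 / 4) \<le> measure (poisson_pmf a) {k. a + 6 * sqrt a \<le> real k}"
proof -
  let ?p = "poisson_pmf a" and ?r = "sqrt a"
  have r: "1 \<le> ?r" "?r * ?r = a" using a by auto
  define I where "I = {k. \<bar>real k - a\<bar> < 2 * ?r}"
  define j where "j = nat \<lceil>8 * ?r\<rceil>"
  have j: "8 * ?r \<le> real j" "real j \<le> 9 * ?r" using r unfolding j_def by linarith+
  have "I \<subseteq> {..nat \<lceil>a + 2 * ?r\<rceil>}" unfolding I_def by (auto simp: abs_less_iff) linarith
  then have fin: "finite I" using finite_subset by blast
  have "measure ?p {k. 2 * ?r \<le> \<bar>real k - a\<bar>} \<le> a / (2 * ?r)\<^sup>2"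
    using a r by (intro poisson_pmf_concentration) auto
  also have "\<dots> = 1 / 4" using a by (simp add: power2_eq_square)
  also have "{k. 2 * ?r \<le> \<bar>real k - a\<bar>} = - I" by (auto simp: I_def)
  finally have I: "3 / 4 \<le> measure ?p I"
    using measure_pmf.prob_compl[of I ?p] by (simp add: Compl_eq_Diff_UNIV)
  have shift: "exp (- 99) * pmf ?p k \<le> pmf ?p (k + j)" if "k \<in> I" for k
  proof -
    have "real (k + j) \<le> a + 11 * ?r" using that j by (auto simp: I_def)
    also have "\<dots> = a * (1 + 11 / ?r)" using r by (simp add: field_simps)
    also have "\<dots> \<le> a * exp (11 / ?r)" using a by (intro mult_left_mono) auto
    finally have "real (k + j) ^ j \<le> (a * exp (11 / ?r)) ^ j" by (intro power_mono) auto
    also have "\<dots> = a ^ j * exp (real j * (11 / ?r))"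
      by (simp only: power_mult_distrib exp_of_nat_mult)
    also have "\<dots> \<le> a ^ j * exp 99"
      using a r j by (intro mult_left_mono) (auto simp: field_simps)
    finally have "pmf ?p k * a ^ j \<le> pmf ?p (k + j) * (a ^ j * exp 99)"
      using poisson_pmf_shift[of a j j k] a
      by (meson mult_left_mono order_trans order_refl pmf_nonneg less_le_trans zero_less_one)
    then have "pmf ?p k \<le> pmf ?p (k + j) * exp 99"
      using a by (simp add: field_simps)
    then show ?thesis by (simp add: exp_minus field_simps)
  qed
  have "exp (- 99) * (3 / 4) \<le> exp (- 99) * (\<Sum>k\<in>I. pmf ?p k)"
    using I fin by (simp add: measure_measure_pmf_finite)
  also have "\<dots> \<le> (\<Sum>k\<in>I. pmf ?p (k + j))"
    unfolding sum_distrib_left by (intro sum_mono shift)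
  also have "\<dots> = measure ?p ((\<lambda>k. k + j) ` I)"
    using fin by (simp add: measure_measure_pmf_finite sum.reindex)
  also have "\<dots> \<le> measure ?p {k. a + 6 * ?r \<le> real k}"
    using j by (intro measure_pmf.finite_measure_mono) (auto simp: I_def)
  finally show ?thesis .
qed

section \<open>Long-run profit on a lane whose carriers never stay\<close>

lemma sets_poisson [simp, measurable_cong]: "sets (poisson a) = sets (count_space UNIV)"
  and space_poisson [simp]: "space (poisson a) = UNIV"
  by (auto simp: poisson_def)

lemma prob_space_poisson: "prob_space (poisson a)"
  unfolding poisson_def by (rule prob_space_measure_pmf)

lemma poisson_mean:
  assumes "0 \<le> a"
  shows "integrable (poisson a) real" "(\<integral>k. real k \<partial>poisson a) = a"
  using assms poisson_pmf_moments(1,2)[of a]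
  by (auto simp: poisson_def integrable_measure_pmf_finite)

lemma distr_pair_snd:
  assumes "prob_space A" "prob_space B"
  shows "distr (A \<Otimes>\<^sub>M B) B snd = B"
proof -
  interpret A: prob_space A by fact
  interpret B: prob_space B by fact
  interpret P: pair_sigma_finite B A ..
  interpret Q: pair_sigma_finite A B ..
  have "distr (A \<Otimes>\<^sub>M B) B snd = distr (distr (B \<Otimes>\<^sub>M A) (A \<Otimes>\<^sub>M B) (\<lambda>(x, y). (y, x))) B snd"
    by (subst Q.distr_pair_swap) simp
  also have "\<dots> = distr (B \<Otimes>\<^sub>M A) B fst"
    by (subst distr_distr) (auto simp: comp_def case_prod_beta)
  also have "\<dots> = B" by (rule A.distr_pair_fst)
  finally show ?thesis .
qed

lemma AE_pair_sndI:
  assumes "prob_space M" "prob_space N" "AE x in N. P x"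
  shows "AE x in M \<Otimes>\<^sub>M N. P (snd x)"
proof -
  have "AE x in distr (M \<Otimes>\<^sub>M N) N snd. P x" unfolding distr_pair_snd[OF assms(1,2)] by (rule assms(3))
  then show ?thesis by (rule AE_distrD[rotated]) simp
qed

lemma average_tendsto_if_eventually_constant:
  fixes f :: "nat \<Rightarrow> real"
  assumes "\<And>t. f (Suc t) = g"
  shows "(\<lambda>T. (\<Sum>t<T. f t) / real T) \<longlonglongrightarrow> g"
proof -
  have sum: "(\<Sum>t<Suc T. f t) = (f 0 - g) + real (Suc T) * g" for T
    by (subst sum.lessThan_Suc_shift) (simp add: assms algebra_simps)
  have "(\<lambda>T. (f 0 - g) / real T + g) \<longlonglongrightarrow> 0 + g"
    by (intro tendsto_add lim_const_over_n tendsto_const)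
  moreover have "\<forall>\<^sub>F T in sequentially. (f 0 - g) / real T + g = (\<Sum>t<T. f t) / real T"
    using eventually_gt_at_top[of 0]
  proof eventually_elim
    case (elim T)
    then obtain T' where "T = Suc T'" by (cases T) auto
    then show ?case unfolding sum[of T'] \<open>T = Suc T'\<close> by (simp add: add_divide_distrib del: of_nat_Suc)
  qed
  ultimately show ?thesis by (simp add: filterlim_cong[OF refl refl])
qed

text \<open>The joint law of the bids of an unlimited supply of carriers, the number of loads and the number of
carriers.\<close>

definition period_law :: "real \<Rightarrow> real \<Rightarrow> real \<Rightarrow> ((nat \<Rightarrow> real) \<times> nat \<times> nat) measure" where
  "period_law a \<mu> \<nu> = bid_space a \<Otimes>\<^sub>M (poisson \<mu> \<Otimes>\<^sub>M poisson \<nu>)"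

lemma prob_space_period_law: "prob_space (period_law a \<mu> \<nu>)"
  unfolding period_law_def
  by (intro prob_space_pair prob_space_bid_space prob_space_poisson)

lemma sets_period_law:
  "sets (period_law a \<mu> \<nu>) = sets ((\<Pi>\<^sub>M s\<in>UNIV. borel) \<Otimes>\<^sub>M (count_space UNIV \<Otimes>\<^sub>M count_space UNIV))"
  unfolding period_law_def by (intro sets_pair_measure_cong sets_bid_space sets_poisson)

lemma measurable_period_law [measurable]:
  "fst \<in> period_law a \<mu> \<nu> \<rightarrow>\<^sub>M (\<Pi>\<^sub>M s\<in>UNIV. borel)"
  "(\<lambda>z. fst (snd z)) \<in> period_law a \<mu> \<nu> \<rightarrow>\<^sub>M count_space UNIV"
  "(\<lambda>z. snd (snd z)) \<in> period_law a \<mu> \<nu> \<rightarrow>\<^sub>M count_space UNIV"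
  unfolding measurable_cong_sets[OF sets_period_law refl] by measurable

lemma period_loads_mean:
  assumes "0 \<le> \<mu>"
  shows "integrable (period_law a \<mu> \<nu>) (\<lambda>z. real (fst (snd z)))"
    "(\<integral>z. real (fst (snd z)) \<partial>period_law a \<mu> \<nu>) = \<mu>"
proof -
  let ?P = "poisson \<mu> \<Otimes>\<^sub>M poisson \<nu>"
  have fst: "distr ?P (poisson \<mu>) fst = poisson \<mu>"
    by (rule prob_space.distr_pair_fst[OF prob_space_poisson])
  have snd: "distr (period_law a \<mu> \<nu>) ?P snd = ?P"
    unfolding period_law_def
    by (intro distr_pair_snd prob_space_bid_space prob_space_pair prob_space_poisson)
  have msnd: "snd \<in> period_law a \<mu> \<nu> \<rightarrow>\<^sub>M ?P" by (simp add: period_law_def)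
  have mfst: "fst \<in> ?P \<rightarrow>\<^sub>M poisson \<mu>" by simp
  have "distr (period_law a \<mu> \<nu>) (poisson \<mu>) (fst \<circ> snd) = poisson \<mu>"
    unfolding distr_distr[OF mfst msnd, symmetric] snd fst ..
  moreover have "fst \<circ> snd \<in> period_law a \<mu> \<nu> \<rightarrow>\<^sub>M poisson \<mu>"
    using msnd mfst by (rule measurable_comp)
  ultimately show "integrable (period_law a \<mu> \<nu>) (\<lambda>z. real (fst (snd z)))"
    "(\<integral>z. real (fst (snd z)) \<partial>period_law a \<mu> \<nu>) = \<mu>"
    using integrable_distr_eq[of "fst \<circ> snd" "period_law a \<mu> \<nu>" "poisson \<mu>" real]
      integral_distr[of "fst \<circ> snd" "period_law a \<mu> \<nu>" "poisson \<mu>" real]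
      poisson_mean[OF assms] by simp_all
qed

lemma measurable_of_bids_loads_carriers:
  assumes "\<And>n d. f n d \<in> (\<Pi>\<^sub>M s\<in>UNIV. borel) \<rightarrow>\<^sub>M N"
    and [measurable]: "c \<in> M \<rightarrow>\<^sub>M (\<Pi>\<^sub>M s\<in>UNIV. borel)"
      "n \<in> M \<rightarrow>\<^sub>M count_space UNIV" "d \<in> M \<rightarrow>\<^sub>M count_space UNIV"
  shows "(\<lambda>\<omega>. f (n \<omega> :: nat) (d \<omega> :: nat) (c \<omega>)) \<in> M \<rightarrow>\<^sub>M N"
proof -
  note [measurable] = assms(1)
  have "(\<lambda>\<omega>. f k l (c \<omega>)) \<in> M \<rightarrow>\<^sub>M N" for k l by measurable
  then have "(\<lambda>\<omega>. f k (d \<omega>) (c \<omega>)) \<in> M \<rightarrow>\<^sub>M N" for k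
    by (rule measurable_compose_countable) measurable
  then show ?thesis by (rule measurable_compose_countable) measurable
qed

text \<open>What the long-run analysis needs to know about the outcome on a lane for \<open>n\<close> carriers, \<open>d\<close> loads and
bids \<open>c\<close>: the loads transported and the payment are measurable, and the payment is at most \<open>x\<close> per
transported load, so that the profit is bounded by a multiple of the number of loads.\<close>

locale bounded_outcome =
  fixes \<phi> :: "nat \<Rightarrow> nat \<Rightarrow> (nat \<Rightarrow> real) \<Rightarrow> nat \<times> real" and x :: real
  assumes transported_measurable: "\<And>n d. (\<lambda>c. fst (\<phi> n d c)) \<in> (\<Pi>\<^sub>M s\<in>UNIV. borel) \<rightarrow>\<^sub>M count_space UNIV"
    and payment_measurable: "\<And>n d. (\<lambda>c. snd (\<phi> n d c)) \<in> borel_measurable (\<Pi>\<^sub>M s\<in>UNIV. borel)"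
    and transported_le: "\<And>n d c. fst (\<phi> n d c) \<le> d"
    and payment_nonneg: "\<And>n d c. 0 \<le> snd (\<phi> n d c)"
    and payment_le: "\<And>n d c. snd (\<phi> n d c) \<le> x * real (fst (\<phi> n d c))"
    and reserve_nonneg: "0 \<le> x"
begin

definition period_profit :: "real \<Rightarrow> real \<Rightarrow> nat \<Rightarrow> nat \<Rightarrow> (nat \<Rightarrow> real) \<Rightarrow> real" where
  "period_profit R b n d c = R - b * (real d - real (fst (\<phi> n d c))) - snd (\<phi> n d c)"

lemma period_profit_measurable: "period_profit R b n d \<in> borel_measurable (\<Pi>\<^sub>M s\<in>UNIV. borel)"
  using transported_measurable[of n d] payment_measurable[of n d]
  unfolding period_profit_def[abs_def] by measurable

lemma period_profit_bounded:
  assumes "0 \<le> b"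
  shows "\<bar>period_profit R b n d c\<bar> \<le> \<bar>R\<bar> + (b + x) * real d"
proof -
  have "b * (real d - real (fst (\<phi> n d c))) \<le> b * real d" "0 \<le> b * (real d - real (fst (\<phi> n d c)))"
    "x * real (fst (\<phi> n d c)) \<le> x * real d"
    using assms transported_le[of n d c] reserve_nonneg by (auto intro: mult_left_mono)
  then show ?thesis
    using payment_nonneg[of n d c] payment_le[of n d c]
    by (auto simp: period_profit_def algebra_simps abs_le_iff)
qed

lemma period_profit_between:
  assumes "x \<le> b"
  shows "R - b * real d \<le> period_profit R b n d c" "period_profit R b n d c \<le> R"
proof -
  let ?y = "real (fst (\<phi> n d c))"
  have "x * ?y \<le> b * ?y" "0 \<le> b * (real d - ?y)"
    using assms reserve_nonneg transported_le[of n d c] by (auto intro: mult_right_mono)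
  then show "R - b * real d \<le> period_profit R b n d c" "period_profit R b n d c \<le> R"
    using payment_nonneg[of n d c] payment_le[of n d c]
    by (auto simp: period_profit_def right_diff_distrib)
qed

lemma integrable_period_profit:
  assumes "0 \<le> b" "0 \<le> \<mu>"
  shows "integrable (period_law a \<mu> \<nu>) (\<lambda>(c, d, n). period_profit R b n d c)"
proof -
  interpret P: prob_space "period_law a \<mu> \<nu>" by (rule prob_space_period_law)
  show ?thesis
  proof (rule Bochner_Integration.integrable_bound)
    show "integrable (period_law a \<mu> \<nu>) (\<lambda>z. \<bar>R\<bar> + (b + x) * real (fst (snd z)))"
      using period_loads_mean(1)[OF assms(2)] by (intro Bochner_Integration.integrable_add integrable_mult_right) auto
    show "(\<lambda>(c, d, n). period_profit R b n d c) \<in> borel_measurable (period_law a \<mu> \<nu>)"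
      unfolding case_prod_beta
      by (rule measurable_of_bids_loads_carriers[OF period_profit_measurable]) measurable
    show "AE z in period_law a \<mu> \<nu>. norm (case z of (c, d, n) \<Rightarrow> period_profit R b n d c)
        \<le> norm (\<bar>R\<bar> + (b + x) * real (fst (snd z)))"
      by (intro AE_I2)
        (simp add: case_prod_beta order_trans[OF period_profit_bounded[OF assms(1)] abs_ge_self])
  qed
qed

lemma expected_period_profit_between:
  fixes R a \<nu> :: real
  assumes "x \<le> b" "0 \<le> \<mu>"
  defines "g \<equiv> (\<integral>(c, d, n). period_profit R b n d c \<partial>period_law a \<mu> \<nu>)"
  shows "R - b * \<mu> \<le> g" "g \<le> R"
proof -
  interpret P: prob_space "period_law a \<mu> \<nu>" by (rule prob_space_period_law)
  have b: "0 \<le> b" using assms(1) reserve_nonneg by simp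
  note int = integrable_period_profit[OF b assms(2)]
  have "R - b * \<mu> = (\<integral>z. R - b * real (fst (snd z)) \<partial>period_law a \<mu> \<nu>)"
    using period_loads_mean[OF assms(2), of a \<nu>] by (simp add: P.prob_space)
  also have "\<dots> \<le> g"
    unfolding g_def using period_profit_between(1)[OF assms(1)] period_loads_mean(1)[OF assms(2)]
    by (intro integral_mono int) (auto simp: case_prod_beta)
  finally show "R - b * \<mu> \<le> g" .
  have "g \<le> (\<integral>z. R \<partial>period_law a \<mu> \<nu>)"
    unfolding g_def using period_profit_between(2)[OF assms(1)]
    by (intro integral_mono int) (auto simp: case_prod_beta)
  then show "g \<le> R" by (simp add: P.prob_space)
qed

end

text \<open>If nobody stays, the carriers of every period but the first are the newly arrived ones, and the
profits of these periods are identically distributed.\<close>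

locale memoryless_lane =
  fixes m :: market and j :: nat and r :: "lane \<Rightarrow> real"
  assumes lanes_eq: "lanes m = {(j, j)}" and nodes_eq: "nodes m = {j}"
    and stay_0: "stay m (j, j) = 0" and sensitivity_1: "sensitivity m = 1" and j_pos: "0 < j"
begin

abbreviation "a \<equiv> avg_cost m (j, j)"
abbreviation "\<mu> \<equiv> demand m (j, j) (r (j, j))"
abbreviation "\<nu> \<equiv> arrival m j"

definition bids :: "noise \<Rightarrow> nat \<Rightarrow> real" where
  "bids z = (\<lambda>s. a - noise_shocks z (j, s, j) + noise_shocks z (j, s, 0))"

lemma cost_eq_bids: "(\<lambda>s. cost m (noise_shocks z) j s j) = bids z"
  by (simp add: cost_def bids_def sensitivity_1)

lemma measurable_noise [measurable]:
  "bids \<in> noise_space m r \<rightarrow>\<^sub>M (\<Pi>\<^sub>M s\<in>UNIV. borel)"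
  "(\<lambda>z. noise_loads z (j, j)) \<in> noise_space m r \<rightarrow>\<^sub>M count_space UNIV"
  "(\<lambda>z. noise_arrivals z j) \<in> noise_space m r \<rightarrow>\<^sub>M count_space UNIV"
  "(\<lambda>z. noise_staying z ((j, j), y)) \<in> noise_space m r \<rightarrow>\<^sub>M count_space UNIV"
proof -
  have shock: "(\<lambda>z. noise_shocks z k) \<in> borel_measurable (noise_space m r)" for k
    unfolding noise_shocks_def noise_space_def shock_space_def case_prod_beta by measurable
  show "bids \<in> noise_space m r \<rightarrow>\<^sub>M (\<Pi>\<^sub>M s\<in>UNIV. borel)"
    unfolding bids_def[abs_def] by (intro measurable_PiM_single') (auto intro!: borel_measurable_add borel_measurable_diff shock)
  show "(\<lambda>z. noise_loads z (j, j)) \<in> noise_space m r \<rightarrow>\<^sub>M count_space UNIV"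
    unfolding noise_loads_def noise_space_def case_prod_beta lanes_eq by measurable
  show "(\<lambda>z. noise_arrivals z j) \<in> noise_space m r \<rightarrow>\<^sub>M count_space UNIV"
    unfolding noise_arrivals_def noise_space_def case_prod_beta nodes_eq by measurable
  have "(\<lambda>f. f ((j, j), y)) \<in> Pi\<^sub>M (lanes m \<times> UNIV) (\<lambda>(l, y). measure_pmf (binomial_pmf y (stay m l)))
      \<rightarrow>\<^sub>M measure_pmf (binomial_pmf y (stay m (j, j)))"
    using measurable_component_singleton[of "((j, j), y)" "lanes m \<times> UNIV"
        "\<lambda>(l, y). measure_pmf (binomial_pmf y (stay m l))"] by (simp add: lanes_eq del: measurable_component_singleton)
  then have c: "(\<lambda>f. f ((j, j), y)) \<in> Pi\<^sub>M (lanes m \<times> UNIV) (\<lambda>(l, y). measure_pmf (binomial_pmf y (stay m l)))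
      \<rightarrow>\<^sub>M count_space UNIV" by (simp cong: measurable_cong_sets)
  have "(\<lambda>z. snd (snd (snd z))) \<in> noise_space m r \<rightarrow>\<^sub>M
      Pi\<^sub>M (lanes m \<times> UNIV) (\<lambda>(l, y). measure_pmf (binomial_pmf y (stay m l)))"
    unfolding noise_space_def by measurable
  from measurable_compose[OF this c]
  show "(\<lambda>z. noise_staying z ((j, j), y)) \<in> noise_space m r \<rightarrow>\<^sub>M count_space UNIV"
    by (simp add: noise_staying_def case_prod_beta)
qed

lemma measurable_period:
  "(\<lambda>z. (bids z, noise_loads z (j, j), noise_arrivals z j)) \<in> noise_space m r \<rightarrow>\<^sub>M period_law a \<mu> \<nu>"
  unfolding measurable_cong_sets[OF refl sets_period_law] by measurable

lemma prob_space_factors: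
  "prob_space (Pi\<^sub>M (lanes m) (\<lambda>l. poisson (demand m l (r l))))"
  "prob_space (Pi\<^sub>M (nodes m) (\<lambda>i. poisson (arrival m i)))"
  "prob_space (Pi\<^sub>M (lanes m \<times> UNIV) (\<lambda>(l, y). measure_pmf (binomial_pmf y (stay m l))))"
  by (auto intro!: prob_space_PiM prob_space_poisson prob_space_measure_pmf)

lemma prob_space_noise: "prob_space (noise_space m r)"
  unfolding noise_space_def by (intro prob_space_pair prob_space_factors prob_space_shock_space)

text \<open>Of the noise of a period only the bids, the loads on the lane and the arrivals at the node matter;
these are independent because they are read off different factors of the noise space.\<close>

lemma distr_noise:
  "distr (noise_space m r) (period_law a \<mu> \<nu>) (\<lambda>z. (bids z, noise_loads z (j, j), noise_arrivals z j)) =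
    period_law a \<mu> \<nu>"
proof -
  let ?D = "Pi\<^sub>M (lanes m) (\<lambda>l. poisson (demand m l (r l)))"
  let ?L = "Pi\<^sub>M (nodes m) (\<lambda>i. poisson (arrival m i))"
  let ?Z = "Pi\<^sub>M (lanes m \<times> UNIV) (\<lambda>(l, y). measure_pmf (binomial_pmf y (stay m l)))"
  let ?g = "\<lambda>e s. a - e (j, s, j) + e (j, s, 0)"
  note ps = prob_space_factors prob_space_shock_space prob_space_poisson prob_space_bid_space
  have g: "?g \<in> shock_space \<rightarrow>\<^sub>M bid_space a"
  proof -
    have "(\<lambda>e. e k) \<in> borel_measurable shock_space" for k
      using measurable_component_singleton[of k UNIV "\<lambda>_. gumbel"]
      by (simp add: shock_space_def cong: measurable_cong_sets)
    then show ?thesis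
      unfolding measurable_cong_sets[OF refl sets_bid_space]
      by (intro measurable_PiM_single') (auto intro!: borel_measurable_add borel_measurable_diff)
  qed
  have 1: "distr shock_space (bid_space a) ?g = bid_space a"
  proof -
    have "distr shock_space (bid_space a) ?g = distr shock_space (\<Pi>\<^sub>M s\<in>UNIV. borel) ?g"
      by (rule distr_cong[OF refl sets_bid_space refl])
    then show ?thesis using distr_bids[of j a j] j_pos by (simp add: bid_space_def)
  qed
  have 2: "distr ?D (poisson \<mu>) (\<lambda>D. D (j, j)) = poisson \<mu>"
    using distr_PiM_component[of "lanes m" "\<lambda>l. poisson (demand m l (r l))" "(j, j)"]
    by (simp add: lanes_eq prob_space_poisson)
  have 3: "distr ?L (poisson \<nu>) (\<lambda>L. L j) = poisson \<nu>"
    using distr_PiM_component[of "nodes m" "\<lambda>i. poisson (arrival m i)" j]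
    by (simp add: nodes_eq prob_space_poisson)
  have mD: "(\<lambda>D. D (j, j)) \<in> ?D \<rightarrow>\<^sub>M poisson \<mu>" and mL: "(\<lambda>L. L j) \<in> ?L \<rightarrow>\<^sub>M poisson \<nu>"
    unfolding lanes_eq nodes_eq by measurable
  have mLZ: "(\<lambda>w. fst w j) \<in> ?L \<Otimes>\<^sub>M ?Z \<rightarrow>\<^sub>M poisson \<nu>" using mL by measurable
  have "distr (?L \<Otimes>\<^sub>M ?Z) (poisson \<nu>) (\<lambda>w. fst w j) =
      distr (distr (?L \<Otimes>\<^sub>M ?Z) ?L fst) (poisson \<nu>) (\<lambda>L. L j)"
    by (subst distr_distr[OF mL]) (auto simp: comp_def)
  also have "\<dots> = poisson \<nu>"
    using prob_space.distr_pair_fst[OF ps(3), of ?L] 3 by simp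
  finally have 4: "distr (?L \<Otimes>\<^sub>M ?Z) (poisson \<nu>) (\<lambda>w. fst w j) = poisson \<nu>" .
  have 5: "poisson \<mu> \<Otimes>\<^sub>M poisson \<nu> = distr (?D \<Otimes>\<^sub>M (?L \<Otimes>\<^sub>M ?Z)) (poisson \<mu> \<Otimes>\<^sub>M poisson \<nu>)
      (\<lambda>(x, y). (x (j, j), fst y j))"
    using pair_measure_distr[OF mD mLZ] by (simp add: 2 4 prob_space_imp_sigma_finite prob_space_poisson)
  have m5: "(\<lambda>(x, y). (x (j, j), fst y j)) \<in> ?D \<Otimes>\<^sub>M (?L \<Otimes>\<^sub>M ?Z) \<rightarrow>\<^sub>M poisson \<mu> \<Otimes>\<^sub>M poisson \<nu>"
    using mD mLZ by measurable
  have "period_law a \<mu> \<nu> = distr (noise_space m r) (period_law a \<mu> \<nu>)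
      (\<lambda>(e, y). (?g e, (\<lambda>(x, y). (x (j, j), fst y j)) y))"
    using pair_measure_distr[OF g m5] unfolding period_law_def noise_space_def 1 5[symmetric]
    by (simp add: prob_space_imp_sigma_finite prob_space_poisson prob_space_pair)
  also have "(\<lambda>(e, y). (?g e, (\<lambda>(x, y). (x (j, j), fst y j)) y)) =
      (\<lambda>z :: noise. (bids z, noise_loads z (j, j), noise_arrivals z j))"
    by (auto simp: fun_eq_iff bids_def noise_shocks_def noise_loads_def noise_arrivals_def)
  finally show ?thesis by simp
qed

lemma nobody_stays: "AE z in noise_space m r. \<forall>y. noise_staying z ((j, j), y) = 0"
proof -
  let ?N = "\<lambda>(l, y). measure_pmf (binomial_pmf y (stay m l))"
  have "AE f in Pi\<^sub>M (lanes m \<times> UNIV) ?N. f ((j, j), y) = 0" for y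
  proof (rule AE_PiM_component)
    show "AE k in ?N ((j, j), y). k = 0"
      unfolding prod.case stay_0 AE_measure_pmf_iff by simp
  qed (auto simp: lanes_eq prob_space_measure_pmf)
  then have "AE f in Pi\<^sub>M (lanes m \<times> UNIV) ?N. \<forall>y. f ((j, j), y) = 0"
    by (simp add: AE_all_countable)
  then have "AE z in noise_space m r. \<forall>y. snd (snd (snd z)) ((j, j), y) = 0"
    unfolding noise_space_def
    by (intro AE_pair_sndI[where P="\<lambda>z. \<forall>y. snd (snd z) ((j, j), y) = 0"]
        AE_pair_sndI[where P="\<lambda>z. \<forall>y. snd z ((j, j), y) = 0"]
        AE_pair_sndI[where P="\<lambda>z. \<forall>y. z ((j, j), y) = 0"]
        prob_space_pair prob_space_factors prob_space_shock_space)
  then show ?thesis by (simp add: noise_staying_def case_prod_beta)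
qed

lemma prob_space_path: "prob_space (path_space m r)"
  unfolding path_space_def by (intro prob_space_PiM prob_space_noise)

lemma measurable_path_noise [measurable]: "(\<lambda>\<omega>. \<omega> t) \<in> path_space m r \<rightarrow>\<^sub>M noise_space m r"
  unfolding path_space_def by measurable

lemma distr_path_noise: "distr (path_space m r) (noise_space m r) (\<lambda>\<omega>. \<omega> t) = noise_space m r"
  unfolding path_space_def by (intro distr_PiM_component prob_space_noise) simp

end

locale memoryless_lane_mechanism = memoryless_lane m j r + bounded_outcome \<phi> x
  for m j r \<phi> x +
  fixes M :: mechanism
  assumes mechanism_eq: "\<And>S D e. M S D e (j, j) = \<phi> (S j) (D (j, j)) (\<lambda>s. cost m e j s j)"
    and penalty_nonneg: "0 \<le> penalty m (j, j)" and demand_nonneg: "0 \<le> \<mu>"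
begin

lemma loads_measurable [measurable]:
  "(\<lambda>\<omega>. loads_at D0 \<omega> t (j, j)) \<in> path_space m r \<rightarrow>\<^sub>M count_space UNIV"
  by (cases t) (simp_all, measurable)

lemma preds_eq: "preds m j = {j}"
  by (auto simp: preds_def lanes_eq)

lemma mechanism_noise_eq: "M S D (noise_shocks z) (j, j) = \<phi> (S j) (D (j, j)) (bids z)"
  by (simp add: mechanism_eq cost_eq_bids)

lemma transported_measurable_path:
  assumes [measurable]: "(\<lambda>\<omega>. S \<omega> j) \<in> path_space m r \<rightarrow>\<^sub>M count_space UNIV"
  shows "(\<lambda>\<omega>. fst (M (S \<omega>) (loads_at D0 \<omega> t) (noise_shocks (\<omega> t)) (j, j)))
    \<in> path_space m r \<rightarrow>\<^sub>M count_space UNIV"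
  unfolding mechanism_noise_eq
  by (rule measurable_of_bids_loads_carriers[OF transported_measurable, where c="\<lambda>\<omega>. bids (\<omega> t)"]) measurable

text \<open>The number of carriers who stay is the member of a countable family of measurable maps selected by
the number of loads transported.\<close>

lemma carriers_measurable [measurable]:
  "(\<lambda>\<omega>. carriers_at m M S0 D0 \<omega> t j) \<in> path_space m r \<rightarrow>\<^sub>M count_space UNIV"
proof (induction t)
  case (Suc t)
  note [measurable] = Suc transported_measurable_path[where S="\<lambda>\<omega>. carriers_at m M S0 D0 \<omega> t", OF Suc]
  have "(\<lambda>\<omega>. noise_staying (\<omega> t) ((j, j),
      fst (M (carriers_at m M S0 D0 \<omega> t) (loads_at D0 \<omega> t) (noise_shocks (\<omega> t)) (j, j))))
    \<in> path_space m r \<rightarrow>\<^sub>M count_space UNIV"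
    by (rule measurable_compose_countable[where f="\<lambda>y \<omega>. noise_staying (\<omega> t) ((j, j), y)"]) measurable
  then show ?case by (simp add: preds_eq)
qed simp

lemma profit_at_eq:
  "profit_at m r M S0 D0 t \<omega> =
    period_profit (r (j, j) * \<mu>) (penalty m (j, j)) (carriers_at m M S0 D0 \<omega> t j) (loads_at D0 \<omega> t (j, j)) (bids (\<omega> t))"
  by (simp add: profit_at_def lanes_eq Let_def mechanism_noise_eq period_profit_def case_prod_beta)

lemma integrable_loads: "integrable (path_space m r) (\<lambda>\<omega>. real (loads_at D0 \<omega> t (j, j)))"
proof (cases t)
  case 0
  interpret prob_space "path_space m r" by (rule prob_space_path)
  show ?thesis by (simp add: 0)
next
  case (Suc t')
  have "integrable (noise_space m r) (\<lambda>z. real (noise_loads z (j, j)))"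
    using integrable_distr[OF measurable_period, of "\<lambda>w. real (fst (snd w))"]
      period_loads_mean(1)[OF demand_nonneg] by (simp add: distr_noise)
  then show ?thesis
    using integrable_distr[OF measurable_path_noise[of "Suc t'"], of "\<lambda>z. real (noise_loads z (j, j))"]
    by (simp add: distr_path_noise Suc)
qed

lemma integrable_profit_at: "integrable (path_space m r) (profit_at m r M S0 D0 t)"
proof (rule Bochner_Integration.integrable_bound)
  interpret prob_space "path_space m r" by (rule prob_space_path)
  let ?R = "r (j, j) * \<mu>" and ?b = "penalty m (j, j)"
  show "integrable (path_space m r) (\<lambda>\<omega>. \<bar>?R\<bar> + (?b + x) * real (loads_at D0 \<omega> t (j, j)))"
    by (intro Bochner_Integration.integrable_add integrable_mult_right integrable_loads) auto
  show "profit_at m r M S0 D0 t \<in> borel_measurable (path_space m r)"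
    unfolding profit_at_eq[abs_def]
    by (rule measurable_of_bids_loads_carriers[OF period_profit_measurable, where c="\<lambda>\<omega>. bids (\<omega> t)"]) measurable
  show "AE \<omega> in path_space m r. norm (profit_at m r M S0 D0 t \<omega>)
      \<le> norm (\<bar>?R\<bar> + (?b + x) * real (loads_at D0 \<omega> t (j, j)))"
    unfolding profit_at_eq
    by (intro AE_I2) (simp add: order_trans[OF period_profit_bounded[OF penalty_nonneg] abs_ge_self])
qed

lemma expected_profit_Suc:
  "(\<integral>\<omega>. profit_at m r M S0 D0 (Suc t) \<omega> \<partial>path_space m r) =
    (\<integral>(c, d, n). period_profit (r (j, j) * \<mu>) (penalty m (j, j)) n d c \<partial>period_law a \<mu> \<nu>)"
proof -
  let ?f = "\<lambda>(c, d, n). period_profit (r (j, j) * \<mu>) (penalty m (j, j)) n d c"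
  let ?s = "\<lambda>z. (bids z, noise_loads z (j, j), noise_arrivals z j)"
  note s = measurable_period
  have f: "?f \<in> borel_measurable (period_law a \<mu> \<nu>)"
    using integrable_period_profit[OF penalty_nonneg demand_nonneg] by auto
  have "AE \<omega> in path_space m r. \<forall>y. noise_staying (\<omega> t) ((j, j), y) = 0"
    unfolding path_space_def by (rule AE_PiM_component[OF prob_space_noise _ nobody_stays]) simp
  then have "AE \<omega> in path_space m r. profit_at m r M S0 D0 (Suc t) \<omega> = ?f (?s (\<omega> (Suc t)))"
    by eventually_elim (simp add: profit_at_eq preds_eq)
  then have "(\<integral>\<omega>. profit_at m r M S0 D0 (Suc t) \<omega> \<partial>path_space m r) =
      (\<integral>\<omega>. ?f (?s (\<omega> (Suc t))) \<partial>path_space m r)"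
    using integrable_profit_at[of S0 D0 "Suc t"]
    by (intro integral_cong_AE measurable_compose[OF measurable_compose[OF measurable_path_noise s] f]) auto
  also have "\<dots> = (\<integral>z. ?f (?s z) \<partial>distr (path_space m r) (noise_space m r) (\<lambda>\<omega>. \<omega> (Suc t)))"
    by (rule integral_distr[symmetric, OF measurable_path_noise measurable_compose[OF s f]])
  also have "\<dots> = (\<integral>z. ?f (?s z) \<partial>noise_space m r)" by (simp only: distr_path_noise)
  also have "\<dots> = (\<integral>w. ?f w \<partial>distr (noise_space m r) (period_law a \<mu> \<nu>) ?s)"
    by (rule integral_distr[symmetric, OF s f])
  finally show ?thesis by (simp only: distr_noise)
qed

text \<open>The initial state affects only the first period, whose share in the averages vanishes.\<close>

theorem long_run_profit_eq_one_period_profit: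
  "long_run_profit m r M
    (\<integral>(c, d, n). period_profit (r (j, j) * \<mu>) (penalty m (j, j)) n d c \<partial>period_law a \<mu> \<nu>)"
  unfolding long_run_profit_def
  by (intro allI conjI integrable_profit_at average_tendsto_if_eventually_constant expected_profit_Suc)

end

section \<open>The profit gap between the mechanisms\<close>

interpretation sp: bounded_outcome "sp_outcome 1" 2
  by unfold_locales
    (auto simp: sp_outcome_def Let_def intro: measurable_sp_outcome[unfolded sp_outcome_def Let_def])

interpretation hyb: bounded_outcome "hyb_outcome 1 2" 2
  by unfold_locales (auto intro: measurable_hyb_outcome hyb_outcome_bounds)

text \<open>The virtual cost \<open>c + 1 + exp (c - 1)\<close> of the instance at \<open>c = 2\<close>, so that the reserve price is 2.\<close>

abbreviation penalty_cost :: real where "penalty_cost \<equiv> 3 + exp 1"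

lemma penalty_cost_bounds: "2 \<le> penalty_cost" "3 < penalty_cost" "penalty_cost \<le> 6"
  using exp_le exp_gt_zero[of "1::real"] by linarith+

abbreviation "gain n d c \<equiv>
  surplus penalty_cost (hyb_outcome 1 2 n d c) - surplus penalty_cost (sp_outcome 1 n d c)"

lemma expected_gain_ge:
  assumes "0 \<le> \<delta>" "\<delta> \<le> 1"
  shows "real n * \<delta> / 6 * measure (bid_space 1) {c. card {t\<in>{..<n}. c t < 1 + \<delta>} < d}
    \<le> (\<integral>c. gain n d c \<partial>bid_space 1)"
  using expected_hybrid_gain[of penalty_cost 1 \<delta> n d] assms by (simp add: one_add_one del: lessThan_iff)

lemma expected_gain_nonneg: "0 \<le> (\<integral>c. gain n d c \<partial>bid_space 1)"
  using expected_gain_ge[of 0 n d] by simp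

text \<open>With \<open>\<delta> = 1 / sqrt \<theta>\<close>, the mean number of bids below \<open>1 + \<delta>\<close> is at most \<open>\<theta> + 9 / 4 * sqrt \<theta>\<close>, which
leaves Hoeffding's inequality a margin of at least \<open>3 * sqrt \<theta>\<close> to \<open>d\<close>. Hence fewer than \<open>d\<close> carriers bid
below \<open>1 + \<delta>\<close> with probability at least one half, and each of the at least \<open>\<theta>\<close> carriers contributes
\<open>\<delta> / 12\<close> or more in expectation.\<close>

lemma expected_gain_scarce_carriers:
  fixes \<theta> :: real
  assumes \<theta>: "9 \<le> \<theta>" and n: "\<bar>real n - 2 * \<theta>\<bar> < 3 * sqrt \<theta>" and d: "\<theta> + 6 * sqrt \<theta> \<le> real d"
  shows "sqrt \<theta> / 12 \<le> (\<integral>c. gain n d c \<partial>bid_space 1)"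
proof -
  interpret prob_space "bid_space 1" by (rule prob_space_bid_space)
  let ?r = "sqrt \<theta>" and ?\<delta> = "1 / sqrt \<theta>"
  have r: "3 \<le> ?r" "?r * ?r = \<theta>" using \<theta> by (auto intro: real_le_rsqrt)
  have "3 * ?r \<le> ?r * ?r" using r by (intro mult_right_mono) auto
  then have n': "\<theta> \<le> real n" "real n \<le> 3 * \<theta>" using n r by (auto simp: abs_less_iff)
  then have n0: "0 < n" using \<theta> by (auto intro: gr0I)
  let ?N = "\<lambda>c. card {t\<in>{..<n}. c t < 1 + ?\<delta>}"
  have "Measurable.pred (bid_space 1) (\<lambda>c. ?N c < d)" by measurable
  from predE[OF this] have ev: "{c. ?N c < d} \<in> events" by simp
  \<comment> \<open>The distribution function has slope at most \<open>1 / 4\<close>, and \<open>n\<close> is at most both \<open>2 * \<theta> + 3 * sqrt \<theta>\<close> and \<open>3 * \<theta>\<close>.\<close>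
  have "real n * logistic (1 + ?\<delta> - 1) + 3 * ?r \<le> real d"
  proof -
    have "real n * logistic ?\<delta> \<le> real n * (1 / 2 + ?\<delta> / 4)"
      using r by (intro mult_left_mono logistic_le_half_plus) auto
    also have "\<dots> = real n / 2 + real n * (?\<delta> / 4)" by (simp add: distrib_left)
    also have "real n * (?\<delta> / 4) \<le> (3 * \<theta>) * (?\<delta> / 4)" using n' r by (intro mult_right_mono) auto
    also have "(3 * \<theta>) * (?\<delta> / 4) = 3 / 4 * ?r"
      using real_div_sqrt[of \<theta>] \<theta> by simp
    finally show ?thesis using n d r by (simp add: abs_less_iff)
  qed
  then have "prob (- {c. ?N c < d}) \<le> prob {c. real n * logistic (1 + ?\<delta> - 1) + 3 * ?r \<le> real (?N c)}"
  proof (intro finite_measure_mono)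
    have "Measurable.pred (bid_space 1) (\<lambda>c. real n * logistic (1 + ?\<delta> - 1) + 3 * ?r \<le> real (?N c))"
      by measurable
    from predE[OF this] show "{c. real n * logistic (1 + ?\<delta> - 1) + 3 * ?r \<le> real (?N c)} \<in> events" by simp
  qed auto
  also have "\<dots> \<le> exp (- 2 * (3 * ?r)\<^sup>2 / real n)"
    using r by (intro prob_many_low_bids n0) auto
  also have "\<dots> \<le> exp (- 1)"
  proof -
    have "(3 * ?r)\<^sup>2 = 9 * \<theta>" using \<theta> by (simp add: power_mult_distrib)
    then show ?thesis using n' n0 \<theta> by (simp add: field_simps)
  qed
  also have "\<dots> \<le> 1 / 2"
    using exp_ge_add_one_self[of 1] by (simp add: exp_minus field_simps)
  finally have "1 / 2 \<le> prob {c. ?N c < d}"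
    using prob_compl[OF ev] by (simp add: Compl_eq_Diff_UNIV)
  have "?r / 12 = \<theta> * ?\<delta> / 6 * (1 / 2)" using real_div_sqrt[of \<theta>] \<theta> by simp
  also have "\<dots> \<le> real n * ?\<delta> / 6 * prob {c. ?N c < d}"
    using n' r \<theta> \<open>1 / 2 \<le> prob {c. ?N c < d}\<close> by (intro mult_mono divide_right_mono mult_right_mono) auto
  also have "\<dots> \<le> (\<integral>c. gain n d c \<partial>bid_space 1)"
    using \<theta> by (intro expected_gain_ge) (auto simp: divide_le_eq_1)
  finally show ?thesis .
qed

definition expected_profit :: "(nat \<Rightarrow> nat \<Rightarrow> (nat \<Rightarrow> real) \<Rightarrow> nat \<times> real) \<Rightarrow> nat \<Rightarrow> real" where
  "expected_profit \<phi> \<theta> = (\<integral>(c, d, n). bounded_outcome.period_profit \<phi> (10 * real \<theta>) penalty_cost n d c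
    \<partial>period_law 1 (real \<theta>) (2 * real \<theta>))"

text \<open>The shipper price 10 exceeds the penalty, so the profit is of order \<open>\<theta>\<close> even if no load is served.\<close>

lemma expected_profit_between:
  assumes "bounded_outcome \<phi> 2"
  shows "4 * real \<theta> \<le> expected_profit \<phi> \<theta>" "expected_profit \<phi> \<theta> \<le> 10 * real \<theta>"
proof -
  interpret bounded_outcome \<phi> 2 by fact
  have "penalty_cost * real \<theta> \<le> 6 * real \<theta>"
    using penalty_cost_bounds by (intro mult_right_mono) auto
  then show "4 * real \<theta> \<le> expected_profit \<phi> \<theta>"
    using expected_period_profit_between(1)[OF penalty_cost_bounds(1), where \<mu>="real \<theta>" and R="10 * real \<theta>" and a=1 and \<nu>="2 * real \<theta>"]
    by (simp add: expected_profit_def)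
  show "expected_profit \<phi> \<theta> \<le> 10 * real \<theta>"
    using expected_period_profit_between(2)[OF penalty_cost_bounds(1), where \<mu>="real \<theta>" and R="10 * real \<theta>" and a=1 and \<nu>="2 * real \<theta>"]
    by (simp add: expected_profit_def)
qed

text \<open>The expected gain is nonnegative for all numbers of loads and carriers, so it may be restricted to
the event on which \<open>expected_gain_scarce_carriers\<close> applies.\<close>

lemma expected_profit_gap:
  assumes \<theta>: "9 \<le> \<theta>"
  shows "exp (- 99) * (3 / 4) * (7 / 9) / 12 * sqrt (real \<theta>)
    \<le> expected_profit (hyb_outcome 1 2) \<theta> - expected_profit (sp_outcome 1) \<theta>"
proof -
  let ?t = "real \<theta>"
  let ?DN = "poisson ?t \<Otimes>\<^sub>M poisson (2 * ?t)"
  interpret B: prob_space "bid_space 1" by (rule prob_space_bid_space)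
  interpret DN: prob_space ?DN by (intro prob_space_pair prob_space_poisson)
  interpret N: prob_space "poisson (2 * ?t)" by (rule prob_space_poisson)
  interpret P: pair_sigma_finite "bid_space 1" ?DN ..
  define A where "A = {d. ?t + 6 * sqrt ?t \<le> real d}"
  define E where "E = {n. \<bar>real n - 2 * ?t\<bar> < 3 * sqrt ?t}"
  have pos: "0 \<le> ?t" "0 \<le> penalty_cost" using penalty_cost_bounds by auto
  note intH = hyb.integrable_period_profit[OF pos(2,1), of 1 "2 * ?t" "10 * ?t"]
  note intS = sp.integrable_period_profit[OF pos(2,1), of 1 "2 * ?t" "10 * ?t"]
  have diff: "hyb.period_profit R penalty_cost n d c - sp.period_profit R penalty_cost n d c = gain n d c" for R n d c
    by (simp add: hyb.period_profit_def sp.period_profit_def surplus_def algebra_simps)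
  have int: "integrable (bid_space 1 \<Otimes>\<^sub>M ?DN) (\<lambda>(c, d, n). gain n d c)"
    using Bochner_Integration.integrable_diff[OF intH intS]
    by (simp add: diff case_prod_beta' period_law_def)
  have "expected_profit (hyb_outcome 1 2) \<theta> - expected_profit (sp_outcome 1) \<theta> =
      (\<integral>w. (case w of (c, d, n) \<Rightarrow> gain n d c) \<partial>(bid_space 1 \<Otimes>\<^sub>M ?DN))"
    using Bochner_Integration.integral_diff[OF intH intS]
    by (simp add: expected_profit_def diff case_prod_beta' period_law_def)
  also have "\<dots> = (\<integral>z. \<integral>c. gain (snd z) (fst z) c \<partial>bid_space 1 \<partial>?DN)"
    using P.integral_snd[of "\<lambda>c z. gain (snd z) (fst z) c"] int by (simp add: case_prod_beta')
  finally have gap: "expected_profit (hyb_outcome 1 2) \<theta> - expected_profit (sp_outcome 1) \<theta> =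
      (\<integral>z. \<integral>c. gain (snd z) (fst z) c \<partial>bid_space 1 \<partial>?DN)" .
  have "exp (- 99) * (3 / 4) \<le> measure (poisson ?t) A"
    using poisson_pmf_upper_deviation[of ?t] \<theta> by (simp add: A_def poisson_def)
  moreover have "7 / 9 \<le> measure (poisson (2 * ?t)) E"
  proof -
    have "measure (poisson_pmf (2 * ?t)) {n. 3 * sqrt ?t \<le> \<bar>real n - 2 * ?t\<bar>} \<le> 2 * ?t / (3 * sqrt ?t)\<^sup>2"
      using \<theta> by (intro poisson_pmf_concentration) auto
    also have "\<dots> = 2 / 9" using \<theta> by (simp add: power_mult_distrib)
    also have "{n. 3 * sqrt ?t \<le> \<bar>real n - 2 * ?t\<bar>} = - E" by (auto simp: E_def)
    finally show ?thesis
      using measure_pmf.prob_compl[of E "poisson_pmf (2 * ?t)"] \<theta>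
      by (simp add: Compl_eq_Diff_UNIV poisson_def)
  qed
  ultimately have "exp (- 99) * (3 / 4) * (7 / 9) \<le> measure (poisson ?t) A * measure (poisson (2 * ?t)) E"
    by (intro mult_mono) auto
  also have "\<dots> = measure ?DN (A \<times> E)"
    by (simp add: measure_def N.emeasure_pair_measure_Times enn2real_mult)
  finally have "exp (- 99) * (3 / 4) * (7 / 9) / 12 * sqrt ?t \<le> sqrt ?t / 12 * measure ?DN (A \<times> E)"
    using mult_left_mono[of "exp (- 99) * (3 / 4) * (7 / 9)" "measure ?DN (A \<times> E)" "sqrt ?t / 12"]
    by (simp add: mult_ac)
  also have "\<dots> = (\<integral>z. sqrt ?t / 12 * indicator (A \<times> E) z \<partial>?DN)"
    by simp
  also have "\<dots> \<le> (\<integral>z. \<integral>c. gain (snd z) (fst z) c \<partial>bid_space 1 \<partial>?DN)"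
  proof (rule integral_mono)
    have "A \<times> E \<in> sets ?DN" by (intro pair_measureI) auto
    then show "integrable ?DN (\<lambda>z. sqrt ?t / 12 * indicator (A \<times> E) z)"
      by (intro integrable_mult_right integrable_real_indicator) (simp_all add: less_top[symmetric])
    show "integrable ?DN (\<lambda>z. \<integral>c. gain (snd z) (fst z) c \<partial>bid_space 1)"
      using P.integrable_snd[of "\<lambda>c z. gain (snd z) (fst z) c"] int by (simp add: case_prod_beta')
    fix z
    show "sqrt ?t / 12 * indicator (A \<times> E) z \<le> (\<integral>c. gain (snd z) (fst z) c \<partial>bid_space 1)"
    proof (cases "z \<in> A \<times> E")
      case True
      then show ?thesis
        using expected_gain_scarce_carriers[of ?t "snd z" "fst z"] \<theta> by (auto simp: A_def E_def)
    next
      case False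
      then show ?thesis using expected_gain_nonneg[of "snd z" "fst z"] by simp
    qed
  qed
  finally show ?thesis by (simp add: gap)
qed

section \<open>The instance and its fluid optimum\<close>

text \<open>The demand \<open>2 - x / 10\<close> gives the revenue \<open>(20 - 10 * d) * d\<close>, which is largest at the smallest
possible demand \<open>d = 1\<close>. Twice as many carriers arrive, so that the price at which half of them accept
clears the fluid market, and the penalty makes it optimal to serve all loads.\<close>

definition lane_market :: market where
  "lane_market = \<lparr>num_nodes = 1, lanes = {(1, 1)}, prices = (\<lambda>_. {0..10}), demand = (\<lambda>_ x. 2 - x / 10),
     penalty = (\<lambda>_. penalty_cost), stay = (\<lambda>_. 0), arrival = (\<lambda>_. 2), avg_cost = (\<lambda>_. 1), sensitivity = 1\<rparr>"

lemma demand_image: "(\<lambda>x::real. 2 - x / 10) ` {0..10} = {1..2}"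
proof (intro equalityI subsetI)
  fix d :: real assume "d \<in> {1..2}"
  then show "d \<in> (\<lambda>x. 2 - x / 10) ` {0..10}" by (intro image_eqI[of _ _ "20 - 10 * d"]) (auto simp: field_simps)
qed auto

lemma inv_demand_lane_market: "d \<in> {1..2} \<Longrightarrow> inv_demand lane_market l d = 20 - 10 * d"
  unfolding inv_demand_def by (rule the_inv_into_f_eq) (auto simp: lane_market_def inj_on_def field_simps)

lemma valid_lane_market: "valid_market lane_market"
proof -
  have "concave_on {1..2} (\<lambda>d. inv_demand lane_market (1, 1) d * d)"
    unfolding concave_on_iff
  proof (intro conjI ballI allI impI)
    fix x y u v :: real
    assume xy: "x \<in> {1..2}" "y \<in> {1..2}" and uv: "0 \<le> u" "0 \<le> v" "u + v = 1"
    have mem: "u * x + v * y \<in> {1..2}"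
      using convexD[of "{1..2::real}" x y u v] xy uv by simp
    have v: "v = 1 - u" using uv by simp
    have "0 \<le> 10 * (u * v) * (x - y)\<^sup>2" using uv by simp
    also have "\<dots> = (20 - 10 * (u * x + v * y)) * (u * x + v * y)
        - (u * ((20 - 10 * x) * x) + v * ((20 - 10 * y) * y))"
      unfolding v by (simp add: power2_eq_square algebra_simps)
    finally show "u * (inv_demand lane_market (1, 1) x * x) + v * (inv_demand lane_market (1, 1) y * y)
        \<le> inv_demand lane_market (1, 1) (u *\<^sub>R x + v *\<^sub>R y) * (u *\<^sub>R x + v *\<^sub>R y)"
      using inv_demand_lane_market[OF xy(1)] inv_demand_lane_market[OF xy(2)] inv_demand_lane_market[OF mem] by simp
  qed simp
  then show ?thesis
    using penalty_cost_bounds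
    by (auto simp: valid_market_def lane_market_def nodes_def demand_image monotone_on_def)
qed

lemma fluid_feasible_lane_market:
  "fluid_feasible lane_market d y v \<longleftrightarrow>
    y (1, 1) + v 1 = 2 \<and> d (1, 1) \<in> {1..2} \<and> 0 \<le> y (1, 1) \<and> y (1, 1) \<le> d (1, 1) \<and> 0 \<le> v 1 \<and>
    (v 1 = 0 \<longrightarrow> y (1, 1) = 0)"
  unfolding fluid_feasible_def
  by (auto simp: lane_market_def nodes_def preds_def succs_def demand_image)

lemma fluid_objective_lane_market:
  assumes "d (1, 1) \<in> {1..2}"
  shows "fluid_objective lane_market d y v = (20 - 10 * d (1, 1)) * d (1, 1)
    - (ln (y (1, 1) / v 1) + 1) * y (1, 1) - penalty_cost * (d (1, 1) - y (1, 1))"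
  using inv_demand_lane_market[OF assms, of "(1, 1)"]
  by (simp add: fluid_objective_def lane_market_def)

text \<open>Since \<open>y * ln (v / y) \<le> v - y\<close>, the entropy term is bounded by a linear one that is tight for
\<open>y = v\<close>; what remains is a concave quadratic in \<open>d\<close> and linear in \<open>y\<close>. The bound equals 9 at
\<open>d = y = 1\<close> and is smaller at every other feasible point because \<open>d \<ge> 1\<close>, \<open>y \<le> d\<close> and the penalty
exceeds 3.\<close>

lemma fluid_objective_le:
  assumes f: "fluid_feasible lane_market d y v"
  shows "fluid_objective lane_market d y v
    \<le> 12 - 3 * d (1, 1) - (penalty_cost - 3) * (d (1, 1) - y (1, 1))"
proof -
  let ?d = "d (1, 1)" and ?y = "y (1, 1)" and ?v = "v 1"
  define w where "w = (penalty_cost - 3) * (?d - ?y)"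
  have f': "?y + ?v = 2" "?d \<in> {1..2}" "0 \<le> ?y" "?y \<le> ?d" "0 < ?v"
    using f by (auto simp: fluid_feasible_lane_market order_le_less)
  have "?y - ?v \<le> ?y * ln (?y / ?v)"
  proof (cases "?y = 0")
    case False
    then have "ln (?v / ?y) \<le> ?v / ?y - 1" using f' by (intro ln_le_minus_one) auto
    then have "?y * ln (?v / ?y) \<le> ?y * (?v / ?y - 1)" using f' by (intro mult_left_mono) auto
    moreover have "?y * (?v / ?y - 1) = ?v - ?y" using False by (simp add: right_diff_distrib)
    moreover have "ln (?v / ?y) = - ln (?y / ?v)" using f' False by (simp add: ln_div)
    ultimately show ?thesis by simp
  qed (use f' in auto)
  moreover have "fluid_objective lane_market d y v = 10 - 10 * (?d - 1)\<^sup>2 - ?y * ln (?y / ?v) - ?y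
      - 3 * ?d + 3 * ?y - w"
    unfolding w_def fluid_objective_lane_market[of d y v, OF f'(2)]
    by (simp add: power2_eq_square algebra_simps)
  moreover have "0 \<le> 10 * (?d - 1)\<^sup>2" by simp
  ultimately show ?thesis using f'(1) unfolding w_def[symmetric] by linarith
qed

lemma fluid_optimal_lane_market:
  "fluid_optimal lane_market d y v \<longleftrightarrow> d (1, 1) = 1 \<and> y (1, 1) = 1 \<and> v 1 = 1"
proof
  assume opt: "fluid_optimal lane_market d y v"
  have "fluid_feasible lane_market (\<lambda>_. 1) (\<lambda>_. 1) (\<lambda>_. 1)" by (simp add: fluid_feasible_lane_market)
  moreover have "fluid_objective lane_market (\<lambda>_. 1) (\<lambda>_. 1) (\<lambda>_. 1) = 9"
    by (simp add: fluid_objective_lane_market)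
  ultimately have "9 \<le> fluid_objective lane_market d y v" and f: "fluid_feasible lane_market d y v"
    using opt unfolding fluid_optimal_def by force+
  then have "3 * (d (1, 1) - 1) + (penalty_cost - 3) * (d (1, 1) - y (1, 1)) \<le> 0"
    using fluid_objective_le[OF f] by simp
  moreover have f': "y (1, 1) + v 1 = 2" "1 \<le> d (1, 1)" "y (1, 1) \<le> d (1, 1)"
    using f by (auto simp: fluid_feasible_lane_market)
  moreover have "0 \<le> (penalty_cost - 3) * (d (1, 1) - y (1, 1))"
    using penalty_cost_bounds f' by (intro mult_nonneg_nonneg) auto
  ultimately have "3 * (d (1, 1) - 1) = 0 \<and> (penalty_cost - 3) * (d (1, 1) - y (1, 1)) = 0"
    by (subst add_nonneg_eq_0_iff[symmetric]) (auto intro: order_antisym)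
  then show "d (1, 1) = 1 \<and> y (1, 1) = 1 \<and> v 1 = 1" using f' penalty_cost_bounds(2) by simp
next
  assume 1: "d (1, 1) = 1 \<and> y (1, 1) = 1 \<and> v 1 = 1"
  have "fluid_objective lane_market d' y' v' \<le> 9" if f: "fluid_feasible lane_market d' y' v'" for d' y' v'
  proof -
    define w where "w = (penalty_cost - 3) * (d' (1, 1) - y' (1, 1))"
    have "0 \<le> w" "1 \<le> d' (1, 1)"
      using penalty_cost_bounds f unfolding w_def
      by (auto intro!: mult_nonneg_nonneg simp: fluid_feasible_lane_market)
    then show ?thesis
      using fluid_objective_le[OF f] unfolding w_def[symmetric] by linarith
  qed
  then show "fluid_optimal lane_market d y v"
    using 1 by (simp add: fluid_optimal_def fluid_feasible_lane_market fluid_objective_lane_market)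
qed

lemma cost_cdf_single_lane:
  assumes "succs m i = {j}" "sensitivity m = 1" "0 < j"
  shows "cost_cdf m p (i, j) c = logistic (c - avg_cost m (i, j))"
proof -
  interpret prob_space shock_space by (rule prob_space_shock_space)
  let ?a = "avg_cost m (i, j)"
  let ?g = "\<lambda>e. ?a - e (i, 0, j) + e (i, 0, 0)"
  have k: "(\<lambda>e. e k) \<in> borel_measurable shock_space" for k
    using measurable_component_singleton[of k UNIV "\<lambda>_. gumbel"]
    by (simp add: shock_space_def cong: measurable_cong_sets)
  have g: "?g \<in> borel_measurable shock_space"
    by (intro borel_measurable_add borel_measurable_diff k) simp
  have "cost_cdf m p (i, j) c = prob {e \<in> space shock_space. ?g e \<le> c}"
    using assms prob_space by (simp add: cost_cdf_def cond_prob_def cost_def)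
  also have "\<dots> = measure (distr shock_space borel ?g) {..c}"
    using g by (subst measure_distr) (auto intro!: arg_cong2[where f=measure])
  also have "\<dots> = logistic (c - ?a)"
    using assms by (simp add: distr_bid measure_logistic_law_atMost)
  finally show ?thesis .
qed

text \<open>On a single lane the conditioning event in \<open>cost_cdf\<close> is trivial, and the logistic distribution
function \<open>L\<close> has density \<open>L * (1 - L)\<close>.\<close>

lemma virtual_cost_single_lane:
  assumes "succs m i = {j}" "sensitivity m = 1" "0 < j"
  shows "virtual_cost m p (i, j) c = c + 1 + exp (c - avg_cost m (i, j))"
proof -
  let ?a = "avg_cost m (i, j)" and ?L = "logistic (c - avg_cost m (i, j))"
  have F: "cost_cdf m p (i, j) = (\<lambda>c. logistic (c - ?a))"
    using cost_cdf_single_lane[OF assms] by blast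
  have "((\<lambda>c. logistic (c - ?a)) has_real_derivative ?L * (1 - ?L) * 1) (at c)"
    by (rule DERIV_chain2[OF DERIV_logistic]) (auto intro!: derivative_eq_intros)
  then have "deriv (cost_cdf m p (i, j)) c = ?L * (1 - ?L)"
    unfolding F by (intro DERIV_imp_deriv) simp
  then have "virtual_cost m p (i, j) c = c + ?L / (?L * (1 - ?L))"
    by (simp add: virtual_cost_def F)
  also have "?L / (?L * (1 - ?L)) = 1 / (1 - ?L)"
    using logistic_pos[of "c - ?a"] by simp
  also have "\<dots> = 1 + exp (c - ?a)"
  proof -
    have "1 - ?L = exp (- (c - ?a)) / (1 + exp (- (c - ?a)))"
      using add_pos_pos[OF zero_less_one exp_gt_zero[of "- (c - ?a)"]]
      unfolding logistic_def by (subst diff_divide_eq_iff) auto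
    then have "1 / (1 - ?L) = (1 + exp (- (c - ?a))) / exp (- (c - ?a))" by simp
    also have "\<dots> = 1 + inverse (exp (- (c - ?a)))" by (simp add: add_divide_distrib inverse_eq_divide)
    also have "inverse (exp (- (c - ?a))) = exp (c - ?a)" by (metis exp_minus minus_minus)
    finally show ?thesis .
  qed
  finally show ?thesis by simp
qed

lemma reserve_price_lane_market:
  assumes "p (1, 1) = 1"
  shows "reserve_price (scaled \<theta> lane_market) p (1, 1) = 2"
proof -
  let ?m = "scaled \<theta> lane_market"
  have psi: "virtual_cost ?m p (1, 1) = (\<lambda>c. c + 1 + exp (c - 1))"
    by (intro ext, subst virtual_cost_single_lane) (auto simp: scaled_def lane_market_def succs_def)
  have "strict_mono (\<lambda>c::real. c + 1 + exp (c - 1))"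
    by (intro strict_monoI) (simp add: add_strict_mono)
  then have "inj (\<lambda>c::real. c + 1 + exp (c - 1))" by (rule strict_mono_imp_inj_on)
  from inv_f_f[OF this, of 2] have "inv (\<lambda>c::real. c + 1 + exp (c - 1)) penalty_cost = 2" by simp
  moreover have "penalty ?m (1, 1) = penalty_cost" by (simp add: scaled_def lane_market_def)
  ultimately show ?thesis unfolding reserve_price_def psi assms by simp
qed

section \<open>The theorem\<close>

lemma long_run_profits_lane_market:
  assumes r: "r (1, 1) = 10" and p: "p (1, 1) = 1"
  shows "long_run_profit (scaled \<theta> lane_market) r (SP (scaled \<theta> lane_market) p)
      (expected_profit (sp_outcome 1) \<theta>)"
    "long_run_profit (scaled \<theta> lane_market) r (HYB (scaled \<theta> lane_market) p)
      (expected_profit (hyb_outcome 1 2) \<theta>)"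
proof -
  let ?m = "scaled \<theta> lane_market"
  have m: "succs ?m 1 = {1}" "0 < sensitivity ?m" "avg_cost ?m (1, 1) = 1" "penalty ?m (1, 1) = penalty_cost"
    "demand ?m (1, 1) 10 = real \<theta>" "arrival ?m 1 = 2 * real \<theta>"
    by (auto simp: scaled_def lane_market_def succs_def)
  interpret memoryless_lane ?m 1 r
    by unfold_locales (auto simp: scaled_def lane_market_def nodes_def)
  have nonneg: "0 \<le> penalty ?m (1, 1)" "0 \<le> demand ?m (1, 1) (r (1, 1))"
    unfolding m r using penalty_cost_bounds(1) by auto
  interpret S: memoryless_lane_mechanism ?m 1 r "sp_outcome 1" 2 "SP ?m p"
    by unfold_locales (fact nonneg SP_single_lane[OF m(1) zero_less_one m(2), of p, unfolded p])+
  interpret H: memoryless_lane_mechanism ?m 1 r "hyb_outcome 1 2" 2 "HYB ?m p"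
    by unfold_locales
      (fact nonneg HYB_single_lane[OF m(1) zero_less_one m(2), of p, unfolded p reserve_price_lane_market[of p, OF p]])+
  show "long_run_profit ?m r (SP ?m p) (expected_profit (sp_outcome 1) \<theta>)"
    using S.long_run_profit_eq_one_period_profit unfolding m r expected_profit_def .
  show "long_run_profit ?m r (HYB ?m p) (expected_profit (hyb_outcome 1 2) \<theta>)"
    using H.long_run_profit_eq_one_period_profit unfolding m r expected_profit_def .
qed

lemma ge_Omega_gap:
  "ge_Omega (\<lambda>\<theta>. expected_profit (hyb_outcome 1 2) \<theta> - expected_profit (sp_outcome 1) \<theta>)
    (\<lambda>\<theta>. sqrt (real \<theta>))"
  unfolding ge_Omega_def
  using eventually_mono[OF eventually_ge_at_top[of 9] expected_profit_gap]
  by (intro exI[of _ "exp (- 99) * (3 / 4) * (7 / 9) / 12"]) auto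

lemma ge_Omega_relative_gap:
  "ge_Omega (\<lambda>\<theta>. 1 - expected_profit (sp_outcome 1) \<theta> / expected_profit (hyb_outcome 1 2) \<theta>)
    (\<lambda>\<theta>. 1 / sqrt (real \<theta>))"
proof -
  let ?H = "expected_profit (hyb_outcome 1 2)" and ?S = "expected_profit (sp_outcome 1)"
  obtain k where k: "0 < k" "\<forall>\<^sub>F \<theta> in sequentially. k * sqrt (real \<theta>) \<le> ?H \<theta> - ?S \<theta>"
    using ge_Omega_gap by (auto simp: ge_Omega_def)
  have "\<forall>\<^sub>F \<theta> in sequentially. k / 10 * (1 / sqrt (real \<theta>)) \<le> 1 - ?S \<theta> / ?H \<theta>"
    using k(2) eventually_gt_at_top[of 0]
  proof eventually_elim
    case (elim \<theta>)
    note H = expected_profit_between[OF hyb.bounded_outcome_axioms, of \<theta>]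
    have pos: "0 < ?H \<theta>" using H(1) elim(2) by simp
    have "k / 10 * (1 / sqrt (real \<theta>)) = k * sqrt (real \<theta>) / (10 * real \<theta>)"
      using elim(2) by (simp add: field_simps)
    also have "\<dots> \<le> k * sqrt (real \<theta>) / ?H \<theta>"
      using k(1) pos H(2) elim(2) by (intro divide_left_mono) auto
    also have "\<dots> \<le> (?H \<theta> - ?S \<theta>) / ?H \<theta>" using elim(1) pos by (intro divide_right_mono) auto
    also have "\<dots> = 1 - ?S \<theta> / ?H \<theta>" using pos by (simp add: diff_divide_distrib)
    finally show ?case .
  qed
  then show ?thesis unfolding ge_Omega_def using k(1) by (intro exI[of _ "k / 10"]) auto
qed

theorem theorem4:
  shows "\<exists>m. valid_market m \<and>
    (\<exists>d y v. fluid_optimal m d y v) \<and>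
    (\<forall>d y v. fluid_optimal m d y v \<longrightarrow>
      0 < fluid_objective m d y v \<and>
      (\<exists>\<gamma>_SP \<gamma>_HYB.
        (\<forall>\<theta>\<ge>1.
          long_run_profit (scaled \<theta> m) (shipper_price m d)
            (SP (scaled \<theta> m) (carrier_price m y v)) (\<gamma>_SP \<theta>) \<and>
          long_run_profit (scaled \<theta> m) (shipper_price m d)
            (HYB (scaled \<theta> m) (carrier_price m y v)) (\<gamma>_HYB \<theta>)) \<and>
        ge_Omega (\<lambda>\<theta>. \<gamma>_HYB \<theta> - \<gamma>_SP \<theta>) (\<lambda>\<theta>. sqrt (real \<theta>)) \<and>
        (\<forall>\<^sub>F \<theta> in sequentially. 0 < \<gamma>_HYB \<theta>) \<and>
        ge_Omega (\<lambda>\<theta>. 1 - \<gamma>_SP \<theta> / \<gamma>_HYB \<theta>) (\<lambda>\<theta>. 1 / sqrt (real \<theta>))))"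
proof (intro exI[of _ lane_market] conjI allI impI)
  show "valid_market lane_market" by (rule valid_lane_market)
  show "\<exists>d y v. fluid_optimal lane_market d y v"
    by (intro exI[of _ "\<lambda>_. 1"]) (simp add: fluid_optimal_lane_market)
next
  fix d y v assume "fluid_optimal lane_market d y v"
  then have opt: "d (1, 1) = 1" "y (1, 1) = 1" "v 1 = 1" by (auto simp: fluid_optimal_lane_market)
  then show "0 < fluid_objective lane_market d y v" by (simp add: fluid_objective_lane_market)
  have prices: "shipper_price lane_market d (1, 1) = 10" "carrier_price lane_market y v (1, 1) = 1"
    using opt inv_demand_lane_market[of 1 "(1, 1)"]
    by (simp_all add: shipper_price_def carrier_price_def) (simp add: lane_market_def)
  have "\<forall>\<^sub>F \<theta> in sequentially. 0 < expected_profit (hyb_outcome 1 2) \<theta>"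
    using eventually_gt_at_top[of 0]
  proof eventually_elim
    case (elim \<theta>)
    then show ?case using expected_profit_between(1)[OF hyb.bounded_outcome_axioms, of \<theta>] by simp
  qed
  then show "\<exists>\<gamma>_SP \<gamma>_HYB.
        (\<forall>\<theta>\<ge>1.
          long_run_profit (scaled \<theta> lane_market) (shipper_price lane_market d)
            (SP (scaled \<theta> lane_market) (carrier_price lane_market y v)) (\<gamma>_SP \<theta>) \<and>
          long_run_profit (scaled \<theta> lane_market) (shipper_price lane_market d)
            (HYB (scaled \<theta> lane_market) (carrier_price lane_market y v)) (\<gamma>_HYB \<theta>)) \<and>
        ge_Omega (\<lambda>\<theta>. \<gamma>_HYB \<theta> - \<gamma>_SP \<theta>) (\<lambda>\<theta>. sqrt (real \<theta>)) \<and>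
        (\<forall>\<^sub>F \<theta> in sequentially. 0 < \<gamma>_HYB \<theta>) \<and>
        ge_Omega (\<lambda>\<theta>. 1 - \<gamma>_SP \<theta> / \<gamma>_HYB \<theta>) (\<lambda>\<theta>. 1 / sqrt (real \<theta>))"
    using long_run_profits_lane_market[of "shipper_price lane_market d" "carrier_price lane_market y v", OF prices] ge_Omega_gap ge_Omega_relative_gap
    by (intro exI[of _ "expected_profit (sp_outcome 1)"] exI[of _ "expected_profit (hyb_outcome 1 2)"]) auto
qed

end
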